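(* As $n\to\infty$, $$g(n,K_3,S_4)=(1+o(1))\frac{n}{3},$$ where $S_4$ is the star with $4$ leaves.
   Context: Constructor-Blocker game: given graphs $H$ and $F$, two players, Constructor and Blocker, alternately claim previously unclaimed edges of the complete graph $K_n$, Constructor moving first. Constructor may only claim an edge if her graph (the edges she has claimed) remains $F$-free (contains no subgraph isomorphic to $F$); Blocker may claim any unclaimed edge. The game ends when Constructor cannot claim any more edges or all edges are claimed. The score is the number of copies of $H$ in Constructor's graph at the end. Constructor maximizes, Blocker minimizes; $g(n,H,F)$ denotes the score under optimal play by both. $S_k$ denotes the star with $k$ leaves (so being $S_k$-free means maximum degree at most $k-1$). *)

theory Defs
  imports Main "HOL-Library.Landau_Symbols"
begin

definition all_edges :: "nat \<Rightarrow> nat set set" where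
  "all_edges n = {e. e \<subseteq> {..<n} \<and> card e = 2}"

definition unclaimed :: "nat \<Rightarrow> nat set set \<Rightarrow> nat set set \<Rightarrow> nat set set" where
  "unclaimed n C B = all_edges n - (C \<union> B)"

definition S4_free :: "nat set set \<Rightarrow> bool" where
  "S4_free G \<longleftrightarrow> \<not> (\<exists>v L. card L = 4 \<and> (\<forall>u\<in>L. {v, u} \<in> G))"

definition triangles :: "nat \<Rightarrow> nat set set \<Rightarrow> nat" where
  "triangles n G = card {T. T \<subseteq> {..<n} \<and> card T = 3 \<and>
                        (\<forall>x\<in>T. \<forall>y\<in>T. x \<noteq> y \<longrightarrow> {x, y} \<in> G)}"

definition constructor_moves :: "nat \<Rightarrow> nat set set \<Rightarrow> nat set set \<Rightarrow> nat set set" where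
  "constructor_moves n C B = {e \<in> unclaimed n C B. S4_free (insert e C)}"

text \<open>Minimax value of the position (C = Constructor's edges, B = Blocker's edges);
  the Boolean is True iff it is Constructor's turn.  The first argument is a fuel
  counter, which equals the number of unclaimed edges when started as in game_value.\<close>
fun gval :: "nat \<Rightarrow> nat \<Rightarrow> bool \<Rightarrow> nat set set \<Rightarrow> nat set set \<Rightarrow> nat" where
  "gval 0 n t C B = triangles n C"
| "gval (Suc k) n True C B =
     (if constructor_moves n C B = {} then triangles n C
      else Max ((\<lambda>e. gval k n False (insert e C) B) ` constructor_moves n C B))"
| "gval (Suc k) n False C B =
     (if constructor_moves n C B = {} \<or> unclaimed n C B = {} then triangles n C
      else Min ((\<lambda>e. gval k n True C (insert e B)) ` unclaimed n C B))"

definition game_value :: "nat \<Rightarrow> nat" where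
  "game_value n = gval (card (all_edges n)) n True {} {}"

end

theory Submission
  imports Defs "HOL-Real_Asymp.Real_Asymp"
begin

text \<open>
  Upper bound. Blocker keeps Constructor's graph free of diamonds (two triangles sharing an edge); as its
  degrees are at most 3, its triangles are then disjoint and number at most \<open>n / 3\<close>. Call an edge
  \<open>s t\<close> live if it may still become the middle edge of a diamond, i.e. if every further neighbour of
  one end is, or can still become, a neighbour of the other. A dead edge never revives, so a move of
  Constructor can only make the new edge live. Blocker maintains that live edges form a matching and have
  degree sum at most 4, plus three conditions that exclude positions with two simultaneous threats.

  Lower bound. Constructor keeps a pool of \<open>O(sqrt n)\<close> vertices of degree at most 1 and plays the path
  \<open>c v d\<close> on unused vertices. If Blocker leaves \<open>c d\<close> open she closes the triangle; otherwise she joins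
  \<open>v\<close> to a pool vertex \<open>b\<close>, which threatens both \<open>b c\<close> and \<open>b d\<close>. The vertex among \<open>c\<close>, \<open>d\<close> left
  over replaces \<open>b\<close> in the pool, so each triangle uses up exactly three vertices.
\<close>

section \<open>Live edges and Blocker's invariant\<close>

text \<open>In the application, \<open>B\<close> also contains every set that is not an edge of the
  board, so the number of vertices does not enter the analysis of positions.\<close>

definition av :: "(nat \<Rightarrow> nat set) \<Rightarrow> nat set set \<Rightarrow> nat \<Rightarrow> nat \<Rightarrow> bool" where
  "av N B a b \<longleftrightarrow> a \<noteq> b \<and> b \<notin> N a \<and> {a, b} \<notin> B \<and> card (N a) < 3 \<and> card (N b) < 3"

definition live :: "(nat \<Rightarrow> nat set) \<Rightarrow> nat set set \<Rightarrow> nat \<Rightarrow> nat \<Rightarrow> bool" where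
  "live N B s t \<longleftrightarrow> t \<in> N s \<and> (\<forall>a\<in>N s - {t}. a \<in> N t \<or> av N B a t)
     \<and> (\<forall>a\<in>N t - {s}. a \<in> N s \<or> av N B a s)"

definition nbrs3 :: "(nat \<Rightarrow> nat set) \<Rightarrow> bool" where
  "nbrs3 N \<longleftrightarrow> (\<forall>a b. b \<in> N a \<longleftrightarrow> a \<in> N b) \<and> (\<forall>a. a \<notin> N a) \<and> (\<forall>a. finite (N a) \<and> card (N a) \<le> 3)"

text \<open>
  The clauses, in order: degree sum of live edges; live edges form a matching; an open pair does not have
  two common neighbours; a full vertex \<open>v\<close> with a live edge to a leaf \<open>c\<close> does not allow a double threat
  after closing \<open>c a\<close>; and the exceptional five-vertex path, which closing to a 4-cycle would exploit.
\<close>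

definition safe :: "(nat \<Rightarrow> nat set) \<Rightarrow> nat set set \<Rightarrow> bool" where
  "safe N B \<longleftrightarrow> nbrs3 N
   \<and> (\<forall>s t. live N B s t \<longrightarrow> card (N s) + card (N t) \<le> 4)
   \<and> (\<forall>v a b. live N B v a \<longrightarrow> live N B v b \<longrightarrow> a = b)
   \<and> (\<forall>s t a b. av N B s t \<longrightarrow> a \<in> N s \<inter> N t \<longrightarrow> b \<in> N s \<inter> N t \<longrightarrow> a = b)
   \<and> (\<forall>v c a. live N B v c \<longrightarrow> card (N v) = 3 \<longrightarrow> N c = {v} \<longrightarrow> a \<in> N v \<longrightarrow> a \<noteq> c \<longrightarrow>
        N a \<noteq> {v} \<and> (\<forall>w\<in>N a. w \<noteq> v \<longrightarrow> card (N w) = 3))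
   \<and> (\<forall>a b c d e. distinct [a, b, c, d, e] \<longrightarrow> N a = {b} \<longrightarrow> N b = {a, c} \<longrightarrow> N c = {b, d} \<longrightarrow>
        N d = {c, e} \<longrightarrow> N e = {d} \<longrightarrow> \<not> (av N B a c \<and> av N B c e))"

section \<open>Effect of a single move on availability, liveness and safety\<close>

definition link :: "nat \<Rightarrow> nat \<Rightarrow> (nat \<Rightarrow> nat set) \<Rightarrow> nat \<Rightarrow> nat set" where
  "link x y N v = (if v = x then insert y (N v) else if v = y then insert x (N v) else N v)"

lemma av_commute: "nbrs3 N \<Longrightarrow> av N B a b \<longleftrightarrow> av N B b a"
  unfolding av_def nbrs3_def by (metis insert_commute)

lemma live_commute: "nbrs3 N \<Longrightarrow> live N B a b \<longleftrightarrow> live N B b a"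
  unfolding live_def nbrs3_def by blast

lemma av_mono: "av N B' a b \<Longrightarrow> B \<subseteq> B' \<Longrightarrow> av N B a b"
  unfolding av_def by blast

lemma live_mono: "live N B' a b \<Longrightarrow> B \<subseteq> B' \<Longrightarrow> live N B a b"
  unfolding live_def using av_mono by blast

text \<open>Availability and liveness occur in \<open>safe\<close> only as premises or under a
  negation, and both shrink as \<open>B\<close> grows. So a surplus move never hurts
  Blocker.\<close>

lemma safe_mono:
  assumes "safe N B" "B \<subseteq> B'"
  shows "safe N B'"
proof -
  note m = live_mono[OF _ assms(2), of N] av_mono[OF _ assms(2), of N]
  show ?thesis
    using assms(1) unfolding safe_def
    apply (elim conjE)
    apply (intro conjI)
    subgoal by assumption
    subgoal using m(1) by meson
    subgoal using m(1) by meson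
    subgoal using m(2) by meson
    subgoal using m(1) by meson
    subgoal using m(2) by meson
    done
qed

lemma link_commute: "x \<noteq> y \<Longrightarrow> link x y N = link y x N"
  by (auto simp: link_def fun_eq_iff)

lemma mem_link: "b \<in> link x y N a \<longleftrightarrow> b \<in> N a \<or> (a = x \<and> b = y) \<or> (a = y \<and> b = x)"
  unfolding link_def by auto

lemma card_link:
  assumes "nbrs3 N" "av N B x y"
  shows "card (link x y N a) = (if a = x \<or> a = y then Suc (card (N a)) else card (N a))"
  using assms unfolding link_def nbrs3_def av_def by auto

lemma nbrs3_link:
  assumes "nbrs3 N" "av N B x y"
  shows "nbrs3 (link x y N)"
  unfolding nbrs3_def
proof (intro conjI allI)
  fix a
  show "card (link x y N a) \<le> 3"
    using card_link[OF assms, of a] assms unfolding nbrs3_def av_def by (auto split: if_splits)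
  show "finite (link x y N a)" "a \<notin> link x y N a"
    using assms unfolding nbrs3_def av_def link_def by auto
  fix b
  show "(b \<in> link x y N a) = (a \<in> link x y N b)"
    using assms unfolding nbrs3_def av_def mem_link by auto
qed

text \<open>Constructor's moves only raise degrees and use up pairs.\<close>

lemma av_link:
  assumes "nbrs3 N" "av N B x y" "av (link x y N) B' a b" "B \<subseteq> B'"
  shows "av N B a b"
  using assms(3,4) card_link[OF assms(1,2), of a] card_link[OF assms(1,2), of b]
  unfolding av_def mem_link by (auto split: if_splits)

text \<open>The only pair that becomes adjacent is \<open>x y\<close>, which was available before.
  Hence whatever makes an old edge live after the move already made it live before.\<close>

lemma live_link:
  assumes "nbrs3 N" "av N B x y" "live (link x y N) B' s t" "B \<subseteq> B'"
  shows "live N B s t \<or> s = x \<and> t = y \<or> s = y \<and> t = x"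
proof (cases "t \<in> N s")
  case True
  have "\<And>a b. a \<in> link x y N b \<or> av (link x y N) B' a b \<Longrightarrow> a \<in> N b \<or> av N B a b"
    using av_link[OF assms(1,2) _ assms(4)] assms(2) av_commute[OF assms(1), of B]
    unfolding mem_link by blast
  moreover have "\<And>a b. a \<in> N b \<Longrightarrow> a \<in> link x y N b" unfolding mem_link by blast
  ultimately show ?thesis
    using assms(3) True unfolding live_def by blast
next
  case False
  then show ?thesis using assms(3) unfolding live_def mem_link by blast
qed

text \<open>Since dead edges stay dead, only configurations at the new edge have to be rechecked.\<close>

lemma safe_linkI:
  fixes N B x y
  defines "N' \<equiv> link x y N"
  assumes safe: "safe N B" and xy: "av N B x y" and sub: "B \<subseteq> B'"
    and Jx: "\<And>p. live N' B' x y \<Longrightarrow> live N' B' x p \<Longrightarrow> p \<in> N x \<Longrightarrow> False"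
    and Jy: "\<And>p. live N' B' x y \<Longrightarrow> live N' B' y p \<Longrightarrow> p \<in> N y \<Longrightarrow> False"
    and Ax: "\<And>p. live N' B' x p \<Longrightarrow> p \<in> N x \<Longrightarrow> p \<noteq> y \<Longrightarrow> card (N x) + card (N p) \<le> 3"
    and Ay: "\<And>p. live N' B' y p \<Longrightarrow> p \<in> N y \<Longrightarrow> p \<noteq> x \<Longrightarrow> card (N y) + card (N p) \<le> 3"
    and Axy: "live N' B' x y \<Longrightarrow> card (N x) + card (N y) \<le> 2"
    and Tx: "\<And>p c. p \<in> N x \<Longrightarrow> av N' B' p y \<Longrightarrow> c \<in> N p \<Longrightarrow> c \<in> N y \<Longrightarrow> c \<noteq> x \<Longrightarrow> False"
    and Ty: "\<And>p c. p \<in> N y \<Longrightarrow> av N' B' p x \<Longrightarrow> c \<in> N p \<Longrightarrow> c \<in> N x \<Longrightarrow> c \<noteq> y \<Longrightarrow> False"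
    and Sx: "\<And>c a. card (N x) = 2 \<Longrightarrow> live N' B' x c \<Longrightarrow> N' c = {x} \<Longrightarrow> a \<in> N' x \<Longrightarrow> a \<noteq> c \<Longrightarrow>
        N' a \<noteq> {x} \<and> (\<forall>w\<in>N' a. w \<noteq> x \<longrightarrow> card (N' w) = 3)"
    and Sy: "\<And>c a. card (N y) = 2 \<Longrightarrow> live N' B' y c \<Longrightarrow> N' c = {y} \<Longrightarrow> a \<in> N' y \<Longrightarrow> a \<noteq> c \<Longrightarrow>
        N' a \<noteq> {y} \<and> (\<forall>w\<in>N' a. w \<noteq> y \<longrightarrow> card (N' w) = 3)"
    and Rax: "\<And>c. N x = {} \<Longrightarrow> N y = {c} \<Longrightarrow> av N' B' x c \<Longrightarrow> False"
    and Ray: "\<And>c. N y = {} \<Longrightarrow> N x = {c} \<Longrightarrow> av N' B' y c \<Longrightarrow> False"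
    and Rbx: "\<And>a d. N x = {a} \<Longrightarrow> N y = {d} \<Longrightarrow> a \<noteq> d \<Longrightarrow> N a = {x} \<Longrightarrow> N d \<noteq> {y} \<Longrightarrow> av N' B' a y \<Longrightarrow> False"
    and Rby: "\<And>a d. N y = {a} \<Longrightarrow> N x = {d} \<Longrightarrow> a \<noteq> d \<Longrightarrow> N a = {y} \<Longrightarrow> N d \<noteq> {x} \<Longrightarrow> av N' B' a x \<Longrightarrow> False"
  shows "safe N' B'"
proof -
  from safe have n3: "nbrs3 N" unfolding safe_def by blast
  have A: "live N B s t \<Longrightarrow> card (N s) + card (N t) \<le> 4" for s t
    using safe unfolding safe_def by meson
  have J: "live N B v a \<Longrightarrow> live N B v b \<Longrightarrow> a = b" for v a b
    using safe unfolding safe_def by meson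
  have T: "av N B s t \<Longrightarrow> a \<in> N s \<inter> N t \<Longrightarrow> b \<in> N s \<inter> N t \<Longrightarrow> a = b" for s t a b
    using safe unfolding safe_def by meson
  have S: "live N B v c \<Longrightarrow> card (N v) = 3 \<Longrightarrow> N c = {v} \<Longrightarrow> a \<in> N v \<Longrightarrow> a \<noteq> c \<Longrightarrow>
        N a \<noteq> {v} \<and> (\<forall>w\<in>N a. w \<noteq> v \<longrightarrow> card (N w) = 3)" for v c a
    using safe unfolding safe_def by meson
  have R0: "distinct [a, b, c, d, e] \<Longrightarrow> N a = {b} \<Longrightarrow> N b = {a, c} \<Longrightarrow> N c = {b, d} \<Longrightarrow>
        N d = {c, e} \<Longrightarrow> N e = {d} \<Longrightarrow> \<not> (av N B a c \<and> av N B c e)" for a b c d e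
    using safe unfolding safe_def by meson
  have n3': "nbrs3 N'" unfolding N'_def by (rule nbrs3_link[OF n3 xy])
  have ne: "x \<noteq> y" "y \<notin> N x" "x \<notin> N y" using xy n3 unfolding av_def nbrs3_def by auto
  have irr: "a \<notin> N a" for a using n3 unfolding nbrs3_def by auto
  have sy: "a \<in> N b \<longleftrightarrow> b \<in> N a" for a b using n3 unfolding nbrs3_def by auto
  note ml = mem_link[of _ x y N, folded N'_def]
  note cl = card_link[OF n3 xy, folded N'_def]
  have avl: "av N' B' a b \<Longrightarrow> av N B a b" for a b
    using av_link[OF n3 xy _ sub] unfolding N'_def by blast
  have lvl: "live N' B' s t \<Longrightarrow> live N B s t \<or> s = x \<and> t = y \<or> s = y \<and> t = x" for s t
    using live_link[OF n3 xy _ sub] unfolding N'_def by blast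
  have lc: "live N' B' a b \<longleftrightarrow> live N' B' b a" for a b by (rule live_commute[OF n3'])
  have nlive: "\<not> live N B x y" "\<not> live N B y x" using ne unfolding live_def by auto
  have mem: "live N' B' s t \<Longrightarrow> t \<in> N' s" for s t unfolding live_def by auto
  have far: "N' v = N v" if "v \<noteq> x" "v \<noteq> y" for v using that unfolding N'_def link_def by auto
  \<comment> \<open>Each end of the new edge gains one degree. This turns the bound 4 into 3 in
    \<open>Ax\<close> and \<open>Ay\<close>, and into 2 in \<open>Axy\<close>.\<close>
  have Alm: "card (N' s) + card (N' t) \<le> 4" if l: "live N' B' s t" for s t
  proof -
    have "t \<in> N' s" "s \<noteq> t" using mem[OF l] n3' unfolding nbrs3_def by auto
    moreover have "live N' B' t s" using l lc by blast
    ultimately show ?thesis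
      using l lvl[OF l] A[of s t] Ax[of t] Ax[of s] Ay[of t] Ay[of s] Axy lc[of x y] ne sy[of s t]
      unfolding cl ml by (auto split: if_splits)
  qed
  have Jm: "a = b" if l: "live N' B' v a" "live N' B' v b" for v a b
  proof (cases "live N B v a \<and> live N B v b")
    case True
    then show ?thesis using J by blast
  next
    case False
    then show ?thesis using lvl[OF l(1)] lvl[OF l(2)] Jx Jy l lc ne mem[OF l(1)] mem[OF l(2)]
      unfolding ml by blast
  qed
  \<comment> \<open>If both common neighbours were already present, the old position had the
    configuration. Otherwise the new edge is a side of the 4-cycle through \<open>s\<close>,
    \<open>a\<close>, \<open>t\<close>, \<open>b\<close>.\<close>
  have Tm: "a = b" if h: "av N' B' s t" "a \<in> N' s \<inter> N' t" "b \<in> N' s \<inter> N' t" for s t a b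
  proof (rule ccontr)
    assume ab: "a \<noteq> b"
    have h': "av N' B' t s" using h(1) av_commute[OF n3'] by blast
    have "av N B s t" using avl h by blast
    then have "\<not> (a \<in> N s \<inter> N t \<and> b \<in> N s \<inter> N t)" using T ab by blast
    moreover have False if "a' \<in> N' s" "a' \<in> N' t" "b' \<in> N' s" "b' \<in> N' t" "a' \<noteq> b'" "a' \<notin> N s \<or> a' \<notin> N t" for a' b'
    proof -
      have st: "s \<noteq> t" using h(1) unfolding av_def by blast
      have *: "False" if "s' = x" "a' = y" "a' \<in> N' t'" "b' \<in> N' s'" "b' \<in> N' t'" "av N' B' t' s'" "s' \<noteq> t'" for s' t'
        using that Ty[of t' b'] ne sy \<open>a' \<noteq> b'\<close> irr unfolding ml by metis
      have **: "False" if "s' = y" "a' = x" "a' \<in> N' t'" "b' \<in> N' s'" "b' \<in> N' t'" "av N' B' t' s'" "s' \<noteq> t'" for s' t'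
        using that Tx[of t' b'] ne sy \<open>a' \<noteq> b'\<close> irr unfolding ml by metis
      from that st have "s = x \<and> a' = y \<or> s = y \<and> a' = x \<or> t = x \<and> a' = y \<or> t = y \<and> a' = x" unfolding ml by blast
      then show False using *[of s t] *[of t s] **[of s t] **[of t s] that st h(1) h' by metis
    qed
    ultimately show False using h ab by (metis IntD1 IntD2 IntI)
  qed
  have Sm: "N' a \<noteq> {v} \<and> (\<forall>w\<in>N' a. w \<noteq> v \<longrightarrow> card (N' w) = 3)"
    if l: "live N' B' v c" and h: "card (N' v) = 3" "N' c = {v}" "a \<in> N' v" "a \<noteq> c" for v c a
  proof (cases "v = x \<or> v = y")
    case True
    then show ?thesis using Sx[of c a] Sy[of c a] l h cl[of v] by auto
  next
    case False
    have l0: "live N B v c" using lvl[OF l] False by blast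
    have c3: "card (N v) = 3" "a \<in> N v" using False h cl[of v] far by auto
    have cn: "c \<noteq> x" "c \<noteq> y" using h(2) ne False unfolding set_eq_iff ml by blast+
    have "N c = {v}" using far[OF cn] h by simp
    from S[OF l0 c3(1) this c3(2) h(4)] have s: "N a \<noteq> {v}" "\<And>w. w \<in> N a \<Longrightarrow> w \<noteq> v \<Longrightarrow> card (N w) = 3" by auto
    have va: "v \<in> N a" using c3 sy by blast
    \<comment> \<open>A neighbour \<open>a\<close> that received the new edge would now be full and
      could no longer be joined to the leaf \<open>c\<close>, so \<open>v c\<close> would be
      dead.\<close>
    have ax: "a \<noteq> x \<and> a \<noteq> y"
    proof (rule ccontr)
      assume "\<not> ?thesis"
      then have axy: "a = x \<or> a = y" by blast
      obtain w where w: "w \<in> N a" "w \<noteq> v" using s(1) va by blast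
      then have "card {w, v} \<le> card (N a)" using va n3 unfolding nbrs3_def by (intro card_mono) auto
      then have "card (N' a) \<ge> 3" using axy w cl[of a] by auto
      then have "\<not> av N' B' a c" unfolding av_def by auto
      moreover have "a \<notin> N' c" using h False axy by auto
      ultimately show False using l h unfolding live_def by blast
    qed
    then have "N' a = N a" using far by blast
    moreover have "card (N' w) = 3" if "w \<in> N a" "w \<noteq> v" for w
      using s(2)[OF that] cl[of w] xy unfolding av_def by auto
    ultimately show ?thesis using s by auto
  qed
  have Rm: "\<not> (av N' B' a c \<and> av N' B' c e)"
    if h: "distinct [a, b, c, d, e]" "N' a = {b}" "N' b = {a, c}" "N' c = {b, d}"
        "N' d = {c, e}" "N' e = {d}" for a b c d e
  proof
    assume as: "av N' B' a c \<and> av N' B' c e"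
    show False
    \<comment> \<open>The five vertices have all their neighbours on the path, so a new edge meeting
      it is one of its four edges. End edges fall under \<open>Rax\<close> and \<open>Ray\<close>,
      inner ones under \<open>Rbx\<close> and \<open>Rby\<close>.\<close>
    proof (cases "x \<in> {a, b, c, d, e} \<or> y \<in> {a, b, c, d, e}")
      case True
      have yx: "y \<in> N' x" and xy': "x \<in> N' y" unfolding ml by auto
      have "N' v \<subseteq> {a, b, c, d, e}" if "v \<in> {a, b, c, d, e}" for v
        using that h(2-) by (elim insertE emptyE) simp_all
      then have "x \<in> {a, b, c, d, e}" using True xy' by blast
      moreover have "x = a \<Longrightarrow> y = b" "x = b \<Longrightarrow> y = a \<or> y = c" "x = c \<Longrightarrow> y = b \<or> y = d"
        "x = d \<Longrightarrow> y = c \<or> y = e" "x = e \<Longrightarrow> y = d"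
        using yx h(2-) by simp_all
      moreover have av': "av N' B' c a" "av N' B' e c" using as av_commute[OF n3'] by auto
      moreover have Nx: "N x = N' x - {y}" "N y = N' y - {x}" using ne unfolding N'_def link_def by auto
      have ds: "a \<noteq> b" "a \<noteq> c" "a \<noteq> d" "a \<noteq> e" "b \<noteq> c" "b \<noteq> d" "b \<noteq> e" "c \<noteq> d" "c \<noteq> e" "d \<noteq> e"
        using h(1) by auto
      moreover have "\<not> (x = a \<and> y = b)"
      proof
        assume *: "x = a \<and> y = b"
        then have "N a = N' a - {b}" "N b = N' b - {a}" using Nx by auto
        then show False using Rax[of c] as av' h(2-) ds * by (simp add: insert_Diff_if)
      qed
      moreover have "\<not> (x = b \<and> y = a)"
      proof
        assume *: "x = b \<and> y = a"
        then have "N b = N' b - {a}" "N a = N' a - {b}" using Nx by auto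
        then show False using Ray[of c] as av' h(2-) ds * by (simp add: insert_Diff_if)
      qed
      moreover have "\<not> (x = e \<and> y = d)"
      proof
        assume *: "x = e \<and> y = d"
        then have "N e = N' e - {d}" "N d = N' d - {e}" using Nx by auto
        then show False using Rax[of c] as av' h(2-) ds * by (simp add: insert_Diff_if)
      qed
      moreover have "\<not> (x = d \<and> y = e)"
      proof
        assume *: "x = d \<and> y = e"
        then have "N d = N' d - {e}" "N e = N' e - {d}" using Nx by auto
        then show False using Ray[of c] as av' h(2-) ds * by (simp add: insert_Diff_if)
      qed
      moreover have "\<not> (x = b \<and> y = c)"
      proof
        assume *: "x = b \<and> y = c"
        then have "N b = N' b - {c}" "N c = N' c - {b}" using Nx by auto
        moreover have "N a = N' a" "N d = N' d" using far * ds by auto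
        moreover have "N' d \<noteq> {c}" using h ds by (metis insert_iff singletonD)
        ultimately show False using Rbx[of a d] as av' h(2-) ds * by (simp add: insert_Diff_if)
      qed
      moreover have "\<not> (x = c \<and> y = b)"
      proof
        assume *: "x = c \<and> y = b"
        then have "N c = N' c - {b}" "N b = N' b - {c}" using Nx by auto
        moreover have "N a = N' a" "N d = N' d" using far * ds by auto
        moreover have "N' d \<noteq> {c}" using h ds by (metis insert_iff singletonD)
        ultimately show False using Rby[of a d] as av' h(2-) ds * by (simp add: insert_Diff_if)
      qed
      moreover have "\<not> (x = d \<and> y = c)"
      proof
        assume *: "x = d \<and> y = c"
        then have "N d = N' d - {c}" "N c = N' c - {d}" using Nx by auto
        moreover have "N e = N' e" "N b = N' b" using far * ds by auto
        moreover have "N' b \<noteq> {c}" using h ds by (metis insert_iff singletonD)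
        ultimately show False using Rbx[of e b] as av' h(2-) ds * by (simp add: insert_Diff_if)
      qed
      moreover have "\<not> (x = c \<and> y = d)"
      proof
        assume *: "x = c \<and> y = d"
        then have "N c = N' c - {d}" "N d = N' d - {c}" using Nx by auto
        moreover have "N e = N' e" "N b = N' b" using far * ds by auto
        moreover have "N' b \<noteq> {c}" using h ds by (metis insert_iff singletonD)
        ultimately show False using Rby[of e b] as av' h(2-) ds * by (simp add: insert_Diff_if)
      qed
      ultimately show False by blast
    next
      case False
      then have "N a = {b}" "N b = {a, c}" "N c = {b, d}" "N d = {c, e}" "N e = {d}"
        using far h by auto
      then show False using R0[of a b c d e] h(1) as avl by blast
    qed
  qed
  show ?thesis
    unfolding safe_def using n3' Alm Jm Tm Sm Rm by (intro conjI allI impI) (assumption | blast)+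
qed

lemma deadI1: "a \<in> N s \<Longrightarrow> a \<noteq> t \<Longrightarrow> a \<notin> N t \<Longrightarrow> \<not> av N B a t \<Longrightarrow> \<not> live N B s t"
  unfolding live_def by blast

lemma deadI2: "a \<in> N t \<Longrightarrow> a \<noteq> s \<Longrightarrow> a \<notin> N s \<Longrightarrow> \<not> av N B a s \<Longrightarrow> \<not> live N B s t"
  unfolding live_def by blast

lemma not_av_blocked: "\<not> av N (insert {a, b} B) a b" "\<not> av N (insert {a, b} B) b a"
  unfolding av_def by (auto simp: insert_commute)

lemma safeD:
  assumes "safe N B"
  shows "nbrs3 N" "\<And>a b. a \<in> N b \<longleftrightarrow> b \<in> N a" "\<And>a. a \<notin> N a" "\<And>a. finite (N a)" "\<And>a. card (N a) \<le> 3"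
    and "\<And>s t. live N B s t \<Longrightarrow> card (N s) + card (N t) \<le> 4"
    and "\<And>v a b. live N B v a \<Longrightarrow> live N B v b \<Longrightarrow> a = b"
    and "\<And>s t a b. av N B s t \<Longrightarrow> a \<in> N s \<Longrightarrow> a \<in> N t \<Longrightarrow> b \<in> N s \<Longrightarrow> b \<in> N t \<Longrightarrow> a = b"
    and "\<And>v c a. live N B v c \<Longrightarrow> card (N v) = 3 \<Longrightarrow> N c = {v} \<Longrightarrow> a \<in> N v \<Longrightarrow> a \<noteq> c \<Longrightarrow>
        N a \<noteq> {v} \<and> (\<forall>w\<in>N a. w \<noteq> v \<longrightarrow> card (N w) = 3)"
    and "\<And>a b c d e. distinct [a, b, c, d, e] \<Longrightarrow> N a = {b} \<Longrightarrow> N b = {a, c} \<Longrightarrow> N c = {b, d} \<Longrightarrow>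
        N d = {c, e} \<Longrightarrow> N e = {d} \<Longrightarrow> av N B a c \<Longrightarrow> av N B c e \<Longrightarrow> False"
proof -
  from assms show "nbrs3 N" unfolding safe_def by blast
  then show "\<And>a b. a \<in> N b \<longleftrightarrow> b \<in> N a" "\<And>a. a \<notin> N a" "\<And>a. finite (N a)" "\<And>a. card (N a) \<le> 3"
    unfolding nbrs3_def by blast+
  from assms show "\<And>s t. live N B s t \<Longrightarrow> card (N s) + card (N t) \<le> 4"
    and "\<And>v a b. live N B v a \<Longrightarrow> live N B v b \<Longrightarrow> a = b"
    and "\<And>v c a. live N B v c \<Longrightarrow> card (N v) = 3 \<Longrightarrow> N c = {v} \<Longrightarrow> a \<in> N v \<Longrightarrow> a \<noteq> c \<Longrightarrow>
        N a \<noteq> {v} \<and> (\<forall>w\<in>N a. w \<noteq> v \<longrightarrow> card (N w) = 3)"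
    and "\<And>a b c d e. distinct [a, b, c, d, e] \<Longrightarrow> N a = {b} \<Longrightarrow> N b = {a, c} \<Longrightarrow> N c = {b, d} \<Longrightarrow>
        N d = {c, e} \<Longrightarrow> N e = {d} \<Longrightarrow> av N B a c \<Longrightarrow> av N B c e \<Longrightarrow> False"
    unfolding safe_def by meson+
  from assms show "\<And>s t a b. av N B s t \<Longrightarrow> a \<in> N s \<Longrightarrow> a \<in> N t \<Longrightarrow> b \<in> N s \<Longrightarrow> b \<in> N t \<Longrightarrow> a = b"
    unfolding safe_def by (meson IntI)
qed

section \<open>Blocker's replies\<close>

lemma safe_link_deg_0_0:
  assumes safe: "safe N B" and xy: "av N B x y" and N: "N x = {}" "N y = {}"
  shows "safe (link x y N) B"
  by (rule safe_linkI[OF safe xy order_refl]) (use N in auto)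

text \<open>Both edges at \<open>x\<close> need the pair \<open>p y\<close> in order to be live, so
  one block kills both.\<close>

lemma safe_link_deg_1_0:
  assumes safe: "safe N B" and xy: "av N B x y" and N: "N x = {p}" "N y = {}"
  shows "safe (link x y N) (insert {p, y} B)" (is "safe ?N ?B")
proof -
  note D = safeD[OF safe]
  have ne: "x \<noteq> y" "p \<noteq> x" "p \<noteq> y" "y \<notin> N p" using xy N D(2)[of y p] D(3)[of x] unfolding av_def by auto
  have N': "?N x = {y, p}" "?N y = {x}" "?N p = N p" unfolding link_def using N ne by auto
  note b = not_av_blocked[of ?N p y B]
  have d: "\<not> live ?N ?B x y" "\<not> live ?N ?B x p"
    using b ne N' deadI1[of p ?N x y ?B] deadI1[of y ?N x p ?B] by auto
  show ?thesis
    by (rule safe_linkI[OF safe xy subset_insertI]) (use N d b in auto)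
qed

text \<open>Along \<open>p x y q\<close>, blocking \<open>p y\<close> kills both edges at
  \<open>x\<close>. What remains is the pair \<open>q x\<close>, and \<open>H\<close> ensures that
  it creates neither a second common neighbour nor the exceptional path.\<close>

lemma safe_link_deg_1_1:
  assumes safe: "safe N B" and xy: "av N B x y" and N: "N x = {p}" "N y = {q}" "p \<noteq> q"
    and H: "av N B q x \<Longrightarrow> N p = {x} \<or> av N B p y \<and> N p \<noteq> {x} \<and> N q \<noteq> {y}"
  shows "safe (link x y N) (insert {p, y} B)" (is "safe ?N ?B")
proof -
  note D = safeD[OF safe]
  have ne: "x \<noteq> y" "p \<noteq> x" "p \<noteq> y" "y \<notin> N p" "q \<noteq> x" "q \<noteq> y" "x \<notin> N q" "x \<in> N p" "y \<in> N q"
    using xy N D(2)[of y p] D(2)[of x p] D(2)[of x q] D(2)[of y q] D(3)[of x] D(3)[of y] unfolding av_def by auto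
  have N': "?N x = {y, p}" "?N y = {x, q}" "?N p = N p" "?N q = N q" unfolding link_def using N ne by auto
  note b = not_av_blocked[of ?N p y B]
  have d: "\<not> live ?N ?B x y" "\<not> live ?N ?B x p"
    using b ne N N' deadI1[of p ?N x y ?B] deadI1[of y ?N x p ?B] by auto
  have avl: "av ?N ?B a b \<Longrightarrow> av N B a b" for a b
    using av_link[OF D(1) xy _ subset_insertI] by blast
  have ac: "av N B x q = av N B q x" "av ?N ?B x q = av ?N ?B q x" using av_commute[OF D(1)] av_commute[OF nbrs3_link[OF D(1) xy]] by blast+
  have dq: "card (N q) \<le> 2" if l: "live ?N ?B y q"
  proof -
    have "x \<in> ?N y - {q}" using N' ne by auto
    then have "av ?N ?B x q" using l N' ne unfolding live_def by auto
    then show ?thesis using N' unfolding av_def by auto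
  qed
  show ?thesis
  proof (rule safe_linkI[OF safe xy subset_insertI], goal_cases)
    \<comment> \<open>This is \<open>Ty\<close>. The move would close a 4-cycle
      \<open>p x y q\<close> with both diagonals open; then \<open>p x\<close> and
      \<open>p q\<close> were both live before, against the matching clause.\<close>
    case (7 p' c)
    then have *: "p' = q" "c = p" using N by auto
    have av: "av N B q x" and pq: "p \<in> N q" using 7 * avl by auto
    have "N p \<noteq> {x}" using pq D(2) ne by auto
    then have av2: "av N B p y" using H av by blast
    have "{x, q} \<subseteq> N p" "{p, y} \<subseteq> N q" using pq D(2) ne by auto
    moreover have "card (N p) < 3" "card (N q) < 3" using av av2 unfolding av_def by auto
    ultimately have Nn: "N p = {x, q}" "N q = {p, y}"
      using card_subset_eq[OF D(4), of "{x, q}" p] card_subset_eq[OF D(4), of "{p, y}" q]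
        card_mono[OF D(4), of "{x, q}" p] card_mono[OF D(4), of "{p, y}" q] ne N(3) by auto
    have "live N B p x" "live N B p q" using Nn N av av2 ne ac av_commute[OF D(1)] unfolding live_def by auto
    then show ?case using D(7) ne by blast
  next
    \<comment> \<open>This is \<open>Rby\<close>: the new edge as an inner edge of the exceptional
      path. There \<open>q\<close> is a leaf before the move and \<open>p\<close> is not, which
      \<open>H\<close> rules out.\<close>
    case (13 a d)
    then show ?case using H[OF avl] N by auto
  qed (use N d b dq in auto)
qed

text \<open>The move fills \<open>x\<close>. The block kills \<open>x y\<close> and
  \<open>x p\<close>; \<open>H\<close> ensures that \<open>x q\<close> is dead as well, so no edge
  at \<open>x\<close> is live.\<close>

lemma safe_link_deg_2_le_1:
  assumes safe: "safe N B" and xy: "av N B x y" and N: "N x = {p, q}" "p \<noteq> q" "N y = {} \<or> N y = {r}"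
    and disj: "N x \<inter> N y = {}"
    and H: "N p = {x, q} \<or> N p = {x} \<or> (\<exists>w\<in>N q. w \<noteq> x \<and> w \<noteq> p)"
    and T: "N y = {r} \<Longrightarrow> r \<in> N q \<Longrightarrow> \<not> av N B q y"
  shows "safe (link x y N) (insert {p, y} B)" (is "safe ?N ?B")
proof -
  note D = safeD[OF safe]
  have ne: "x \<noteq> y" "p \<noteq> x" "p \<noteq> y" "y \<notin> N p" "q \<noteq> x" "q \<noteq> y" "y \<notin> N q" "x \<notin> N y" "x \<in> N p" "x \<in> N q"
    using xy N(1) disj D(2)[of y p] D(2)[of x p] D(2)[of x q] D(2)[of y q] D(2)[of x y] D(3)[of x]
    unfolding av_def by auto
  have N': "?N x = {y, p, q}" "?N y = insert x (N y)" "?N p = N p" "?N q = N q" unfolding link_def using N ne by auto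
  have full: "\<not> av ?N ?B a x" "\<not> av ?N ?B x a" for a using N' N ne unfolding av_def by auto
  note b = not_av_blocked[of ?N p y B]
  have avl: "av ?N ?B a b \<Longrightarrow> av N B a b" for a b
    using av_link[OF D(1) xy _ subset_insertI] by blast
  have dead: "\<not> live ?N ?B x y" "\<not> live ?N ?B x p"
    using b ne N N' disj deadI1[of p ?N x y ?B] deadI1[of y ?N x p ?B] by auto
  have deadr: "\<not> live ?N ?B y r" if "N y = {r}"
    using that ne N N' disj full D(2)[of x r] D(3)[of y] deadI1[of x ?N y r ?B] by (auto simp: link_def)
  have deadq: "\<not> live ?N ?B x q"
  proof
    assume l: "live ?N ?B x q"
    have lN: "live N B x q" using live_link[OF D(1) xy l subset_insertI] ne by auto
    show False
    \<comment> \<open>A further neighbour \<open>w\<close> of \<open>q\<close> can no longer be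
      joined to the full vertex \<open>x\<close>. Without such a \<open>w\<close>, \<open>H\<close>
      makes \<open>x p\<close> live in the old position, next to the live edge
      \<open>x q\<close>.\<close>
    proof (cases "\<exists>w\<in>N q. w \<noteq> x \<and> w \<noteq> p")
      case True
      then obtain w where w: "w \<in> N q" "w \<noteq> x" "w \<noteq> p" by blast
      then have "w \<noteq> y" "w \<noteq> q" using ne D(3) by auto
      then show False using l w full N' deadI2[of w ?N q x ?B] by auto
    next
      case False
      then have "live N B x p"
      proof -
        from False H have "N p = {x, q} \<or> N p = {x}" by blast
        then show ?thesis
        proof
          assume "N p = {x, q}"
          then show ?thesis using N(1,2) D(2)[of p q] ne unfolding live_def by auto
        next
          assume *: "N p = {x}"
          then have "p \<notin> N q" using D(2)[of p q] ne by auto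
          then have "av N B p q" using lN N(1,2) unfolding live_def by auto
          then show ?thesis using N(1,2) * av_commute[OF D(1)] unfolding live_def by auto
        qed
      qed
      then show False using D(7) lN N(2) by blast
    qed
  qed
  have dx: "\<not> live ?N ?B x c" for c
    using dead deadq N'(1) by (cases "c \<in> ?N x") (auto simp: live_def)
  show ?thesis
  proof (rule safe_linkI[OF safe xy subset_insertI], goal_cases)
    case (6 p' c)
    then have "p' = q" using N(1) b by auto
    moreover have "N y = {r}" "c = r" using 6 N(3) by auto
    ultimately show ?case using T avl 6 by blast
  next
    case (9 c a)
    then show ?case using N(3) by auto
  qed (use N dx deadr full in auto)
qed

text \<open>The move closes the 4-cycle \<open>x p r y\<close>, and Blocker takes its open diagonal
  \<open>p y\<close>. The edge \<open>x q\<close> may survive as a live edge from a full vertex to a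
  leaf; the last two clauses of \<open>safe\<close> deal with this.\<close>

lemma safe_link_deg_2_1_cycle:
  assumes safe: "safe N B" and xy: "av N B x y" and N: "N x = {p, q}" "p \<noteq> q" "N y = {r}"
    and disj: "r \<noteq> p" "r \<noteq> q" and rp: "r \<in> N p" and py: "av N B p y"
  shows "safe (link x y N) (insert {p, y} B)" (is "safe ?N ?B")
proof -
  note D = safeD[OF safe]
  have ne: "x \<noteq> y" "p \<noteq> x" "p \<noteq> y" "y \<notin> N p" "q \<noteq> x" "q \<noteq> y" "y \<notin> N q" "x \<notin> N y" "x \<in> N p" "x \<in> N q"
     "r \<noteq> x" "r \<noteq> y" "y \<in> N r" "p \<in> N r"
    using xy N disj rp D(2)[of y p] D(2)[of x p] D(2)[of x q] D(2)[of y q] D(2)[of x y]  D(2)[of y r]  D(2)[of p r] D(3)[of x] D(3)[of y]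
    unfolding av_def by auto
  have N': "?N x = {y, p, q}" "?N y = {x, r}" "?N p = N p" "?N q = N q" "?N r = N r"
    unfolding link_def using N ne by auto
  have full: "\<not> av ?N ?B a x" "\<not> av ?N ?B x a" for a using N' N ne unfolding av_def by auto
  note b = not_av_blocked[of ?N p y B]
  have avl: "av ?N ?B a b \<Longrightarrow> av N B a b" for a b
    using av_link[OF D(1) xy _ subset_insertI] by blast
  have dead: "\<not> live ?N ?B x y" "\<not> live ?N ?B x p"
    using b ne N N' disj deadI1[of p ?N x y ?B] deadI1[of y ?N x p ?B] by auto
  have deadr: "\<not> live ?N ?B y r"
    using ne N N' disj full D(2)[of x r] deadI1[of x ?N y r ?B] by auto
  have Np: "N p = {x, r}"
  proof -
    have "{x, r} \<subseteq> N p" using rp ne by auto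
    moreover have "card (N p) < 3" using py unfolding av_def by auto
    ultimately show ?thesis
      using card_seteq[OF D(4), of "{x, r}" p] ne by auto
  qed
  have qp: "q \<notin> N p" "p \<notin> N q" using Np disj ne D(2)[of p q] by auto
  have liveq: "N q = {x} \<and> card (N r) = 3" if l: "live ?N ?B x q"
  proof -
    have "w = x" if "w \<in> N q" for w
    proof (rule ccontr)
      assume "w \<noteq> x"
      moreover have "w \<noteq> q" "w \<noteq> p" "w \<noteq> y" using that D(3) qp ne by auto
      ultimately show False using l that full N' deadI2[of w ?N q x ?B] by auto
    qed
    then have Nq: "N q = {x}" using ne(10) by blast
    have "av ?N ?B p q" using l N' qp N(2) unfolding live_def by auto
    then have avqp: "av N B q p" using avl av_commute[OF D(1)] by blast
    \<comment> \<open>If \<open>r\<close> had only the neighbours \<open>p\<close> and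
      \<open>y\<close>, then \<open>q x p r y\<close> would have been the exceptional path, with
      \<open>q p\<close> and \<open>p y\<close> open.\<close>
    have "card (N r) = 3"
    proof (rule ccontr)
      assume "card (N r) \<noteq> 3"
      then have "card (N r) \<le> 2" using D(5)[of r] by auto
      then have "N r = {p, y}" using card_seteq[OF D(4), of "{p, y}" r] ne by auto
      then show False using D(10)[of q x p r y] Nq Np N ne avqp py disj
        by (auto simp: insert_commute)
    qed
    then show ?thesis using Nq by blast
  qed
  \<comment> \<open>Here \<open>r\<close> would be full with a live edge to the leaf
    \<open>y\<close>. The clause on full vertices then makes \<open>x\<close>, a neighbour of
    \<open>p\<close>, full before the move.\<close>
  have Tq: False if h: "av ?N ?B q y" "r \<in> N q"
  proof -
    have qy: "av N B q y" using h avl by blast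
    have "{p, q, y} \<subseteq> N r" using h ne D(2)[of r q] by auto
    then have Nr: "N r = {p, q, y}" using card_seteq[OF D(4), of "{p, q, y}" r] D(5)[of r] ne N(2) by auto
    then have "live N B r y" using N(3) py qy unfolding live_def by auto
    then have "card (N x) = 3" using D(9)[of r y p] Nr N ne by auto
    then show False using N by auto
  qed
  show ?thesis
  proof (rule safe_linkI[OF safe xy subset_insertI], goal_cases)
    case (6 p' c)
    then have "p' = q" "c = r" using N b by auto
    then show ?case using Tq 6 by blast
  next
    \<comment> \<open>This is \<open>Sx\<close>. The other neighbours of \<open>x\<close> are
      \<open>p\<close> and \<open>y\<close>, and the only further neighbour of either is
      \<open>r\<close>, which is full.\<close>
    case (8 c a)
    then have "c = q" using N' dead unfolding live_def by auto
    then have r3: "card (N r) = 3" using 8 liveq by auto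
    have "a = p \<or> a = y" using 8 N' \<open>c = q\<close> by auto
    then show ?case using N' Np r3 ne by auto
  qed (use N dead deadr full N' liveq in auto)
qed

text \<open>Both ends become full. As their neighbourhoods are disjoint, each edge at
  \<open>x\<close> or \<open>y\<close> lacks an adjacency that can no longer be added.\<close>

lemma safe_link_deg_2_2:
  assumes safe: "safe N B" and xy: "av N B x y" and N: "card (N x) = 2" "card (N y) = 2" "N x \<inter> N y = {}"
  shows "safe (link x y N) B" (is "safe ?N ?B")
proof -
  note D = safeD[OF safe]
  have ne: "x \<noteq> y" "x \<notin> N y" "y \<notin> N x" using xy D(2)[of x y] unfolding av_def by auto
  have full: "\<not> av ?N B a x" "\<not> av ?N B x a" "\<not> av ?N B a y" "\<not> av ?N B y a" for a
    using card_link[OF D(1) xy] N unfolding av_def by auto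
  obtain p where p: "p \<in> N x" using N(1) by fastforce
  have dxy: "\<not> live ?N B x y"
    using p N(3) full ne D(3)[of x] deadI1[of p ?N x y B] unfolding mem_link by auto
  have dx: "\<not> live ?N B x p" if "p \<in> N x" for p
    using that N(3) full ne D(2)[of p y] D(3)[of x] deadI1[of y ?N x p B] unfolding mem_link by auto
  have dy: "\<not> live ?N B y p" if "p \<in> N y" for p
    using that N(3) full ne D(2)[of p x] D(3)[of y] deadI1[of x ?N y p B] unfolding mem_link by auto
  have "\<not> live ?N B x c" "\<not> live ?N B y c" for c
    using dxy dx dy live_commute[OF nbrs3_link[OF D(1) xy]] unfolding live_def mem_link by blast+
  then show ?thesis
    by (intro safe_linkI[OF safe xy order_refl]) (use full N in auto)
qed

section \<open>Replies when the new edge closes a triangle \<open>x y c\<close>\<close>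

text \<open>In these names \<open>mid\<close> refers to the degree of \<open>c\<close>, and
  \<open>deg\<close> to the degrees of \<open>x\<close> and \<open>y\<close> before the move. Here
  all edges at \<open>x\<close> die and only \<open>y c\<close> may be live.\<close>

lemma safe_close_mid2_deg_2_1:
  assumes safe: "safe N B" and xy: "av N B x y" and N: "N c = {x, y}" "N x = {c, w}" "w \<noteq> c" "N y = {c}"
  shows "safe (link x y N) (insert {w, y} B)" (is "safe ?N ?B")
proof -
  note D = safeD[OF safe]
  have ne: "x \<noteq> y" "c \<noteq> x" "c \<noteq> y" "w \<noteq> x" "w \<noteq> y" "w \<notin> N y" "y \<notin> N w" "w \<notin> N c"
    using xy N D(2)[of y w] D(3)[of x] D(3)[of y] unfolding av_def by auto
  have N': "?N x = {y, c, w}" "?N y = {x, c}" "?N c = N c" "?N w = N w"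
    unfolding link_def using N ne by auto
  \<comment> \<open>If \<open>w\<close> could still be joined to \<open>c\<close>, both
    \<open>c x\<close> and \<open>c y\<close> would have been live before the move.\<close>
  have nwc: "\<not> av N B w c"
  proof
    assume "av N B w c"
    then have "live N B c x" "live N B c y"
      using N xy ne av_commute[OF D(1), of B x y] unfolding live_def by auto
    then show False using D(7) ne by blast
  qed
  then have nwc': "\<not> av ?N ?B w c" using av_link[OF D(1) xy _ subset_insertI] by blast
  note b = not_av_blocked[of ?N w y B]
  have "\<not> live ?N ?B x y" "\<not> live ?N ?B x c" "\<not> live ?N ?B x w"
    using b nwc' ne N N' deadI1[of w ?N x y ?B] deadI1[of w ?N x c ?B] deadI1[of y ?N x w ?B] by auto
  then have dx: "\<not> live ?N ?B x a" for a
    using N'(1) by (cases "a \<in> ?N x") (auto simp: live_def)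
  have nc: "\<not> av ?N ?B c a" if "a \<in> N c" for a using that N' unfolding av_def by auto
  show ?thesis
    by (rule safe_linkI[OF safe xy subset_insertI]) (use N dx b ne nc in auto)
qed

text \<open>Both \<open>x\<close> and \<open>y\<close> become full. By \<open>vc\<close> and the
  block, neither outer neighbour can be joined to \<open>c\<close>, so every edge at
  \<open>x\<close> or \<open>y\<close> is dead.\<close>

lemma safe_close_mid2_deg_2_2:
  assumes safe: "safe N B" and xy: "av N B x y"
    and N: "N c = {x, y}" "N x = {c, w}" "w \<noteq> c" "N y = {c, v}" "v \<noteq> c" and vc: "\<not> av N B v c"
  shows "safe (link x y N) (insert {w, c} B)" (is "safe ?N ?B")
proof -
  note D = safeD[OF safe]
  have ne: "x \<noteq> y" "c \<noteq> x" "c \<noteq> y" "w \<noteq> x" "w \<noteq> y" "v \<noteq> x" "v \<noteq> y"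
    using xy N D(2)[of y x] D(3)[of x] D(3)[of y] unfolding av_def by auto
  \<comment> \<open>The open pair \<open>x y\<close> already has the common neighbour
    \<open>c\<close> and admits no second one.\<close>
  have wv: "w \<noteq> v" using D(8)[OF xy, of c w] N by auto
  have ne2: "w \<notin> N y" "y \<notin> N w" "w \<notin> N c" "v \<notin> N x" "x \<notin> N v" "v \<notin> N c"
    using ne wv N D(2)[of y w] D(2)[of x v] by auto
  have N': "?N x = {y, c, w}" "?N y = {x, c, v}" "?N c = N c" "?N w = N w" "?N v = N v"
    unfolding link_def using N ne by auto
  have full: "\<not> av ?N ?B a x" "\<not> av ?N ?B x a" "\<not> av ?N ?B a y" "\<not> av ?N ?B y a" for a
    using N' N ne unfolding av_def by auto
  have vc': "\<not> av ?N ?B v c" using vc av_link[OF D(1) xy _ subset_insertI] by blast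
  note b = not_av_blocked[of ?N w c B]
  have "\<not> live ?N ?B x y" "\<not> live ?N ?B x c" "\<not> live ?N ?B x w"
    using b full wv ne ne2 N N' deadI1[of w ?N x y ?B] deadI1[of w ?N x c ?B] deadI1[of y ?N x w ?B] by auto
  then have dx: "\<not> live ?N ?B x a" for a
    using N'(1) by (cases "a \<in> ?N x") (auto simp: live_def)
  have "\<not> live ?N ?B y x" "\<not> live ?N ?B y c" "\<not> live ?N ?B y v"
    using vc' full wv ne ne2 N N' deadI1[of v ?N y x ?B] deadI1[of v ?N y c ?B] deadI1[of x ?N y v ?B] by auto
  then have dy: "\<not> live ?N ?B y a" for a
    using N'(2) by (cases "a \<in> ?N y") (auto simp: live_def)
  show ?thesis
    by (rule safe_linkI[OF safe xy subset_insertI]) (use N dx dy full in auto)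
qed

text \<open>Once \<open>d\<close> can be joined to neither \<open>x\<close> nor \<open>y\<close>,
  the edges at \<open>c\<close> in the triangle are dead. Only \<open>x y\<close> may stay live,
  with degree sum 4.\<close>

lemma safe_close_mid3_deg_1_1:
  assumes safe: "safe N B" and xy: "av N B x y" and N: "N c = {x, y, d}" "N x = {c}" "N y = {c}"
    and d: "d \<noteq> x" "d \<noteq> y" and dy: "\<not> av N B d y"
  shows "safe (link x y N) (insert {d, x} B)" (is "safe ?N ?B")
proof -
  note D = safeD[OF safe]
  have ne: "x \<noteq> y" "c \<noteq> x" "c \<noteq> y" "d \<noteq> c"
    using xy N D(3)[of x] D(3)[of y] D(3)[of c] unfolding av_def by auto
  have N': "?N x = {y, c}" "?N y = {x, c}" "?N c = N c"
    unfolding link_def using N ne by auto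
  have dy': "\<not> av ?N ?B d y" using dy av_link[OF D(1) xy _ subset_insertI] by blast
  have full: "\<not> av ?N ?B a c" "\<not> av ?N ?B c a" for a using N' N ne d unfolding av_def by auto
  note b = not_av_blocked[of ?N d x B]
  have "\<not> live ?N ?B x c" "\<not> live ?N ?B y c"
    using b dy' ne d N N' deadI2[of d ?N c x ?B] deadI2[of d ?N c y ?B] by auto
  then show ?thesis
    by (intro safe_linkI[OF safe xy subset_insertI]) (use N full in auto)
qed

text \<open>Both \<open>c\<close> and \<open>x\<close> are full, so only the pairs
  \<open>w y\<close> and \<open>d y\<close> matter. The set \<open>B'\<close> is arbitrary because
  either pair may be the one that has to be blocked.\<close>

lemma safe_close_mid3_deg_2_1:
  assumes safe: "safe N B" and xy: "av N B x y" and N: "N c = {x, y, d}" "N x = {c, w}" "w \<noteq> c" "N y = {c}"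
    and d: "d \<noteq> x" "d \<noteq> y" and wd: "w \<noteq> d" and wy: "\<not> av (link x y N) B' w y" and dy: "\<not> av (link x y N) B' d y"
    and sub: "B \<subseteq> B'"
  shows "safe (link x y N) B'" (is "safe ?N ?B")
proof -
  note D = safeD[OF safe]
  have ne: "x \<noteq> y" "c \<noteq> x" "c \<noteq> y" "d \<noteq> c" "w \<noteq> x" "w \<noteq> y" "w \<notin> N y" "w \<notin> N c" "c \<notin> N w"
    using xy N d wd D(2)[of c w] D(3)[of x] D(3)[of y] D(3)[of c] unfolding av_def by auto
  have N': "?N x = {y, c, w}" "?N y = {x, c}" "?N c = N c" "?N w = N w"
    unfolding link_def using N ne by auto
  have full: "\<not> av ?N ?B a c" "\<not> av ?N ?B c a" for a using N' N ne d unfolding av_def by auto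
  have "\<not> live ?N ?B x y" "\<not> live ?N ?B x c" "\<not> live ?N ?B x w"
    using wy full ne N N' deadI1[of w ?N x y ?B] deadI1[of w ?N x c ?B] deadI1[of c ?N x w ?B] by auto
  then have dx: "\<not> live ?N ?B x a" for a
    using N'(1) by (cases "a \<in> ?N x") (auto simp: live_def)
  have "\<not> live ?N ?B y c" using dy d ne N N' deadI2[of d ?N c y ?B] by auto
  then show ?thesis
    by (intro safe_linkI[OF safe xy sub]) (use N full dx wy in auto)
qed

text \<open>All three vertices of the triangle become full and their outer neighbours are distinct,
  so all edges at \<open>x\<close> and \<open>y\<close> are dead.\<close>

lemma safe_close_mid3_deg_2_2:
  assumes safe: "safe N B" and xy: "av N B x y" and N: "N c = {x, y, d}" "N x = {c, w}" "w \<noteq> c" "N y = {c, v}" "v \<noteq> c"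
    and d: "d \<noteq> x" "d \<noteq> y" and wd: "w \<noteq> d" "v \<noteq> d"
  shows "safe (link x y N) B" (is "safe ?N ?B")
proof -
  note D = safeD[OF safe]
  have wv: "w \<noteq> v" using D(8)[OF xy, of c w] N by auto
  have ne: "x \<noteq> y" "c \<noteq> x" "c \<noteq> y" "w \<noteq> x" "w \<noteq> y" "v \<noteq> x" "v \<noteq> y" "d \<noteq> c"
    using xy N d D(2)[of y x] D(3)[of x] D(3)[of y] D(3)[of c] unfolding av_def by auto
  have ne2: "w \<notin> N y" "v \<notin> N x" "w \<notin> N c" "c \<notin> N w" "v \<notin> N c" "c \<notin> N v"
    using N d ne wd wv D(2)[of c w] D(2)[of c v] by auto
  have N': "?N x = {y, c, w}" "?N y = {x, c, v}" "?N c = N c" "?N w = N w" "?N v = N v"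
    unfolding link_def using N ne by auto
  have full: "\<not> av ?N ?B a x" "\<not> av ?N ?B x a" "\<not> av ?N ?B a y" "\<not> av ?N ?B y a"
     "\<not> av ?N ?B a c" "\<not> av ?N ?B c a" for a using N' N ne d unfolding av_def by auto
  have "\<not> live ?N ?B x y" "\<not> live ?N ?B x c" "\<not> live ?N ?B x w"
    using full ne ne2 wv N N' deadI1[of w ?N x y ?B] deadI1[of w ?N x c ?B] deadI1[of c ?N x w ?B] by auto
  then have dx: "\<not> live ?N ?B x a" for a
    using N'(1) by (cases "a \<in> ?N x") (auto simp: live_def)
  have "\<not> live ?N ?B y x" "\<not> live ?N ?B y c" "\<not> live ?N ?B y v"
    using full ne ne2 wv N N' deadI1[of v ?N y x ?B] deadI1[of v ?N y c ?B] deadI1[of c ?N y v ?B] by auto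
  then have dy: "\<not> live ?N ?B y a" for a
    using N'(2) by (cases "a \<in> ?N y") (auto simp: live_def)
  show ?thesis
    by (rule safe_linkI[OF safe xy order_refl]) (use N dx dy full in auto)
qed

section \<open>Choosing the reply by the degrees around the new edge\<close>

lemma card_le_2_cases:
  assumes "finite A" "card A < 3"
  obtains "A = {}" | p where "A = {p}" | p q where "A = {p, q}" "p \<noteq> q"
proof -
  have "card A = 0 \<or> card A = 1 \<or> card A = 2" using assms(2) by linarith
  then show ?thesis using that assms(1) by (auto simp: card_1_singleton_iff card_2_iff)
qed

lemma safe_close_response:
  assumes safe: "safe N B" and xy: "av N B x y" and c: "c \<in> N x" "c \<in> N y" and le: "card (N y) \<le> card (N x)"
  shows "\<exists>e. safe (link x y N) (insert e B)"
proof -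
  note D = safeD[OF safe]
  have cx: "x \<in> N c" "y \<in> N c" using c D(2) by auto
  have ne: "x \<noteq> y" "c \<noteq> x" "c \<noteq> y" using xy c D(3) unfolding av_def by auto
  have yx: "av N B y x" using xy av_commute[OF D(1)] by blast
  have lk: "link y x N = link x y N" by (rule link_commute) (use ne in simp)
  have Nx: "N x = {c} \<or> (\<exists>w. w \<noteq> c \<and> N x = {c, w})"
  proof (cases "N x = {c}")
    case False
    then obtain w where w: "w \<in> N x" "w \<noteq> c" using c by blast
    moreover have "card (N x) \<le> 2" using xy unfolding av_def by auto
    ultimately have "{c, w} = N x" using card_seteq[OF D(4), of "{c, w}" x] c by auto
    then show ?thesis using w(2) by blast
  qed blast
  have Ny: "N y = {c} \<or> (\<exists>w. w \<noteq> c \<and> N y = {c, w})"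
  proof (cases "N y = {c}")
    case False
    then obtain w where w: "w \<in> N y" "w \<noteq> c" using c by blast
    moreover have "card (N y) \<le> 2" using xy unfolding av_def by auto
    ultimately have "{c, w} = N y" using card_seteq[OF D(4), of "{c, w}" y] c by auto
    then show ?thesis using w(2) by blast
  qed blast
  consider (two) "N c = {x, y}" | (three) d where "d \<noteq> x" "d \<noteq> y" "N c = {x, y, d}"
  proof (cases "N c = {x, y}")
    case False
    then obtain d where d: "d \<in> N c" "d \<noteq> x" "d \<noteq> y" using cx by auto
    then have "{x, y, d} = N c" using card_seteq[OF D(4), of "{x, y, d}" c] D(5)[of c] cx ne by auto
    then show ?thesis using that d by blast
  qed (use that in blast)
  then show ?thesis
  proof cases
    case two
    show ?thesis
    proof (cases "N x = {c}")
      case True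
      then have "N y = {c}" using le Ny by auto
      \<comment> \<open>A bare path \<open>x c y\<close> with \<open>x y\<close> open has two live
        edges at \<open>c\<close>, against the matching clause.\<close>
      then have "live N B c x" "live N B c y" using two True xy yx unfolding live_def by auto
      then show ?thesis using D(7) ne by blast
    next
      case False
      then obtain w where w: "w \<noteq> c" "N x = {c, w}" using Nx by blast
      show ?thesis
      proof (cases "N y = {c}")
        case True
        then show ?thesis using safe_close_mid2_deg_2_1[OF safe xy two w(2,1)] by blast
      next
        case False
        then obtain v where v: "v \<noteq> c" "N y = {c, v}" using Ny by blast
        show ?thesis
        \<comment> \<open>At most one of \<open>v\<close>, \<open>w\<close> can still be joined to
          \<open>c\<close>, since otherwise \<open>c x\<close> and \<open>c y\<close> were both
          live. Blocker takes care of that one, if necessary with \<open>x\<close> and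
          \<open>y\<close> exchanged.\<close>
        proof (cases "av N B v c")
          case False
          then show ?thesis using safe_close_mid2_deg_2_2[OF safe xy two w(2,1) v(2,1)] by blast
        next
          case True
          have "\<not> av N B w c"
          proof
            assume wc: "av N B w c"
            have "v \<noteq> x" "w \<noteq> y" using v w xy yx unfolding av_def by auto
            then have "live N B c x" "live N B c y" using two v w True wc xy yx unfolding live_def by auto
            then show False using D(7) ne by blast
          qed
          then show ?thesis
            using safe_close_mid2_deg_2_2[OF safe yx _ v(2,1) w(2,1)] two lk by (auto simp: insert_commute)
        qed
      qed
    qed
  next
    case (three d)
    \<comment> \<open>A second common neighbour \<open>d\<close> of \<open>c\<close> and
      \<open>x'\<close> would have made \<open>c x'\<close> live with degree sum 5.\<close>
    have third: "w \<noteq> d" if "av N B x' y'" "N x' = {c, w}" "{x', y'} = {x, y}" "w \<noteq> c" for x' y' w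
    proof
      assume "w = d"
      moreover have "N c = {x', y', d}" "x' \<noteq> y'" using three(3) that ne(1) by (auto simp: doubleton_eq_iff)
      moreover have "d \<in> N x'" using that \<open>w = d\<close> by auto
      moreover have "av N B y' x'" using that av_commute[OF D(1)] by blast
      ultimately have "live N B c x'" using that(2) unfolding live_def by auto
      moreover have "card (N x') = 2" using that by simp
      moreover have "card (N c) = 3" using three ne by simp
      ultimately show False using D(6) by fastforce
    qed
    show ?thesis
    proof (cases "N x = {c}")
      case True
      then have Ny1: "N y = {c}" using le Ny by auto
      show ?thesis
      proof (cases "av N B d y")
        case False
        then show ?thesis using safe_close_mid3_deg_1_1[OF safe xy three(3) True Ny1 three(1,2)] by blast
      next
        case dy: True
        have "\<not> av N B d x"
        proof
          assume "av N B d x"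
          then have "live N B c x" "live N B c y" using three True Ny1 xy yx dy unfolding live_def by auto
          then show False using D(7) ne by blast
        qed
        then show ?thesis
          using safe_close_mid3_deg_1_1[OF safe yx _ Ny1 True three(2,1)] three(3) lk by (auto simp: insert_commute)
      qed
    next
      case False
      then obtain w where w: "w \<noteq> c" "N x = {c, w}" using Nx by blast
      have wd: "w \<noteq> d" using third[OF xy w(2) refl w(1)] .
      show ?thesis
      proof (cases "N y = {c}")
        case Ny1: True
        \<comment> \<open>Otherwise the full vertex \<open>c\<close> has a live edge to the leaf
          \<open>y\<close>. The clause on full vertices makes \<open>w\<close> full, so
          \<open>w y\<close> was not open. Hence one block closes both pairs.\<close>
        have "\<not> (av N B w y \<and> av N B d y)"
        proof
          assume *: "av N B w y \<and> av N B d y"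
          then have "live N B c y" using three Ny1 xy unfolding live_def by auto
          moreover have "card (N c) = 3" using three ne by simp
          ultimately have "card (N w) = 3" using D(9)[of c y x] Ny1 three w ne by auto
          then show False using * unfolding av_def by auto
        qed
        then have "\<exists>e. \<not> av (link x y N) (insert e B) w y \<and> \<not> av (link x y N) (insert e B) d y"
          using not_av_blocked av_link[OF D(1) xy _ subset_insertI] by metis
        then show ?thesis
          using safe_close_mid3_deg_2_1[OF safe xy three(3) w(2,1) Ny1 three(1,2) wd _ _ subset_insertI] by blast
      next
        case False
        then obtain v where v: "v \<noteq> c" "N y = {c, v}" using Ny by blast
        have "v \<noteq> d" using third[OF yx v(2) _ v(1)] by blast
        then have "safe (link x y N) B"
          using safe_close_mid3_deg_2_2[OF safe xy three(3) w(2,1) v(2,1) three(1,2) wd] by blast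
        then show ?thesis using safe_mono by blast
      qed
    qed
  qed
qed

lemma safe_open_response:
  assumes safe: "safe N B" and xy: "av N B x y" and disj: "N x \<inter> N y = {}" and le: "card (N y) \<le> card (N x)"
  shows "\<exists>e. safe (link x y N) (insert e B)"
proof -
  note D = safeD[OF safe]
  have ne: "x \<noteq> y" using xy unfolding av_def by auto
  have yx: "av N B y x" using xy av_commute[OF D(1)] by blast
  have lk: "link y x N = link x y N" by (rule link_commute) (use ne in simp)
  have fx: "finite (N x)" "card (N x) < 3" and fy: "finite (N y)" "card (N y) < 3"
    using D(4) xy unfolding av_def by auto
  from fx show ?thesis
  proof (cases rule: card_le_2_cases)
    case 1
    then have "N y = {}" using le fy by simp
    then have "safe (link x y N) B" using safe_link_deg_0_0[OF safe xy 1] by blast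
    then show ?thesis using safe_mono by blast
  next
    case (2 p)
    from fy show ?thesis
    proof (cases rule: card_le_2_cases)
      case 1
      then show ?thesis using safe_link_deg_1_0[OF safe xy 2] by blast
    next
      case q: (2 q)
      have pq: "p \<noteq> q" using 2 q disj by auto
      note direct = safe_link_deg_1_1[OF safe xy 2 q pq]
      note swapped = safe_link_deg_1_1[OF safe yx q 2 pq[symmetric], unfolded lk]
      \<comment> \<open>In the first, third and fifth case the hypothesis of \<open>direct\<close>
        holds, in the other two that of \<open>swapped\<close>.\<close>
      consider "\<not> av N B q x" | "\<not> av N B p y" | "N p = {x}" | "N q = {y}"
        | "av N B p y" "N p \<noteq> {x}" "N q \<noteq> {y}" by blast
      then show ?thesis
        by cases (use direct swapped in blast)+
    next
      case 3
      then show ?thesis using le 2 by simp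
    qed
  next
    case (3 p q)
    have xp: "x \<in> N p" "x \<in> N q" using 3 D(2) by auto
    have sw: "N x = {q, p}" "q \<noteq> p" using 3 by auto
    define H where "H p q \<longleftrightarrow> N p = {x, q} \<or> N p = {x} \<or> (\<exists>w\<in>N q. w \<noteq> x \<and> w \<noteq> p)" for p q
    \<comment> \<open>If \<open>H p q\<close> fails, then \<open>N q\<close> lies in
      \<open>{x, p}\<close> and contains \<open>x\<close>, which gives \<open>H q p\<close>.\<close>
    have H: "H p q \<or> H q p" unfolding H_def using xp by blast
    from fy show ?thesis
    proof (cases rule: card_le_2_cases)
      case 1
      have "safe (link x y N) (insert {p, y} B)" if "H p q"
        \<comment> \<open>The value 0 is a dummy: \<open>N y\<close> is empty, so it equals no
          \<open>{r}\<close>.\<close>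
        by (rule safe_link_deg_2_le_1[OF safe xy 3, where r = 0]) (use 1 that in \<open>auto simp: H_def\<close>)
      moreover have "safe (link x y N) (insert {q, y} B)" if "H q p"
        by (rule safe_link_deg_2_le_1[OF safe xy sw, where r = 0]) (use 1 that in \<open>auto simp: H_def\<close>)
      ultimately show ?thesis using H by blast
    next
      case r: (2 r)
      have rn: "r \<noteq> p" "r \<noteq> q" using r 3 disj by auto
      show ?thesis
      proof (cases "r \<in> N p \<and> av N B p y \<or> r \<in> N q \<and> av N B q y")
        case True
        then show ?thesis
          using safe_link_deg_2_1_cycle[OF safe xy 3 r rn] safe_link_deg_2_1_cycle[OF safe xy sw r rn(2,1)] by blast
      next
        case False
        have "safe (link x y N) (insert {p, y} B)" if "H p q"
          by (rule safe_link_deg_2_le_1[OF safe xy 3, where r = r]) (use r False disj that in \<open>auto simp: H_def\<close>)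
        moreover have "safe (link x y N) (insert {q, y} B)" if "H q p"
          by (rule safe_link_deg_2_le_1[OF safe xy sw, where r = r]) (use r False disj that in \<open>auto simp: H_def\<close>)
        ultimately show ?thesis using H by blast
      qed
    next
      case (3 r s)
      then have "safe (link x y N) B"
        using safe_link_deg_2_2[OF safe xy _ _ disj] \<open>N x = {p, q}\<close> \<open>p \<noteq> q\<close> by simp
      then show ?thesis using safe_mono by blast
    qed
  qed
qed

lemma safe_response:
  assumes safe: "safe N B" and xy: "av N B x y"
  shows "\<exists>e. safe (link x y N) (insert e B)"
proof -
  have *: "\<exists>e. safe (link x y N) (insert e B)" if "av N B x y" "card (N y) \<le> card (N x)" for x y
    using safe_close_response[OF safe that(1) _ _ that(2)] safe_open_response[OF safe that(1) _ that(2)] by blast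
  have "av N B y x" using xy av_commute[OF safeD(1)[OF safe]] by blast
  moreover have "link y x N = link x y N" by (rule link_commute) (use xy in \<open>auto simp: av_def\<close>)
  ultimately show ?thesis using *[OF xy] *[of y x] by fastforce
qed

text \<open>The middle edge of a diamond has full ends with the same further neighbours. It is
  therefore live with degree sum 6, above the bound 4.\<close>

lemma safe_diamond_free:
  assumes "safe N B" "t \<in> N s" "a \<in> N s" "a \<in> N t" "b \<in> N s" "b \<in> N t"
  shows "a = b"
proof (rule ccontr)
  assume ab: "a \<noteq> b"
  note D = safeD[OF assms(1)]
  have ne: "s \<noteq> t" "a \<noteq> s" "a \<noteq> t" "b \<noteq> s" "b \<noteq> t" "s \<in> N t" using assms D(2,3) by auto
  have "N s = {t, a, b}" using card_seteq[OF D(4), of "{t, a, b}" s] D(5)[of s] ne ab assms by auto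
  moreover have "N t = {s, a, b}" using card_seteq[OF D(4), of "{s, a, b}" t] D(5)[of t] ne ab assms by auto
  ultimately have "live N B s t" "card (N s) = 3" "card (N t) = 3"
    using assms ne ab unfolding live_def by auto
  then show False using D(6)[of s t] by simp
qed

text \<open>Safety depends on \<open>B\<close> only through availability; this discounts blocks of
  pairs that are already taken or off the board.\<close>

lemma safe_cong:
  assumes "\<And>a b. av N B a b \<longleftrightarrow> av N B' a b"
  shows "safe N B \<longleftrightarrow> safe N B'"
proof -
  have "av N B = av N B'" using assms by (intro ext)
  then show ?thesis unfolding safe_def live_def by simp
qed

section \<open>Upper bound\<close>

definition nb :: "nat set set \<Rightarrow> nat \<Rightarrow> nat set" where
  "nb C v = {u. {v, u} \<in> C}"

lemma finite_all_edges: "finite (all_edges n)"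
  unfolding all_edges_def by (rule finite_subset[of _ "Pow {..<n}"]) auto

lemma doubleton_in_all_edges: "{a, b} \<in> all_edges n \<longleftrightarrow> a < n \<and> b < n \<and> a \<noteq> b"
  unfolding all_edges_def by (auto simp: card_insert_if split: if_splits)

lemma all_edgesE:
  assumes "e \<in> all_edges n"
  obtains x y where "e = {x, y}" "x \<noteq> y" "x < n" "y < n"
proof -
  from assms obtain x y where "e = {x, y}" "x \<noteq> y" unfolding all_edges_def card_2_iff by auto
  then show ?thesis using that assms unfolding all_edges_def by auto
qed

lemma nb_subset: "C \<subseteq> all_edges n \<Longrightarrow> nb C v \<subseteq> {..<n}"
  unfolding nb_def using doubleton_in_all_edges by blast

lemma finite_nb: "C \<subseteq> all_edges n \<Longrightarrow> finite (nb C v)"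
  by (meson nb_subset finite_lessThan finite_subset)

lemma mem_nb: "b \<in> nb C a \<longleftrightarrow> {a, b} \<in> C"
  unfolding nb_def by simp

lemma nb_insert: "x \<noteq> y \<Longrightarrow> nb (insert {x, y} C) = link x y (nb C)"
  by (rule ext) (auto simp: nb_def link_def doubleton_eq_iff)

lemma S4_free_iff:
  assumes "C \<subseteq> all_edges n"
  shows "S4_free C \<longleftrightarrow> (\<forall>v. card (nb C v) \<le> 3)"
proof
  assume f: "S4_free C"
  show "\<forall>v. card (nb C v) \<le> 3"
  proof (rule allI, rule ccontr)
    fix v assume "\<not> card (nb C v) \<le> 3"
    then have "4 \<le> card (nb C v)" by simp
    then obtain L where "L \<subseteq> nb C v" "card L = 4" using obtain_subset_with_card_n by metis
    then show False using f unfolding S4_free_def nb_def by blast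
  qed
next
  assume d: "\<forall>v. card (nb C v) \<le> 3"
  show "S4_free C"
    unfolding S4_free_def
  proof clarify
    fix v L assume L: "card (L :: nat set) = 4" "\<forall>u\<in>L. {v, u} \<in> C"
    then have "L \<subseteq> nb C v" unfolding nb_def by blast
    then have "card L \<le> card (nb C v)" using card_mono finite_nb[OF assms] by blast
    moreover have "card (nb C v) \<le> 3" using d by blast
    ultimately show False using L(1) by simp
  qed
qed

lemma constructor_moveE:
  assumes "C \<subseteq> all_edges n" "e \<in> constructor_moves n C B"
  obtains x y where "e = {x, y}" "av (nb C) (B \<union> - all_edges n) x y" "insert e C \<subseteq> all_edges n"
proof -
  from assms(2) have e: "e \<in> all_edges n" "e \<notin> C" "e \<notin> B" "S4_free (insert e C)"
    unfolding constructor_moves_def unclaimed_def by auto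
  obtain x y where xy: "e = {x, y}" "x \<noteq> y" using e(1) by (rule all_edgesE)
  have sub: "insert e C \<subseteq> all_edges n" using e assms(1) by auto
  have le: "card (link x y (nb C) v) \<le> 3" for v
    using S4_free_iff[OF sub] e(4) nb_insert[OF xy(2), of C] xy(1) by auto
  have "y \<notin> nb C x" "x \<notin> nb C y" using e xy unfolding mem_nb by (auto simp: insert_commute)
  then have "card (nb C x) < 3" "card (nb C y) < 3"
    using le[of x] le[of y] xy(2) finite_nb[OF assms(1)] unfolding link_def by auto
  then have "av (nb C) (B \<union> - all_edges n) x y"
    using e xy unfolding av_def mem_nb by auto
  then show ?thesis using that xy sub by blast
qed

lemma triangles_le_of_safe:
  assumes C: "C \<subseteq> all_edges n" and safe: "safe (nb C) B"
  shows "triangles n C \<le> n div 3"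
proof -
  define F where "F = {T. T \<subseteq> {..<n} \<and> card T = 3 \<and> (\<forall>x\<in>T. \<forall>y\<in>T. x \<noteq> y \<longrightarrow> {x, y} \<in> C)}"
  note D = safeD[OF safe]
  have adj: "y \<in> nb C x" if "T \<in> F" "x \<in> T" "y \<in> T" "x \<noteq> y" for T x y
    using that unfolding F_def mem_nb by auto
  have dis: "T \<inter> T' = {}" if TF: "T \<in> F" "T' \<in> F" "T \<noteq> T'" for T T'
  proof (rule ccontr)
    assume "T \<inter> T' \<noteq> {}"
    then obtain v where v: "v \<in> T" "v \<in> T'" by blast
    have c3: "card T = 3" "card T' = 3" "finite T" "finite T'"
      using TF unfolding F_def by (auto simp: card_ge_0_finite)
    have cT: "card (T - {v}) = 2" "card (T' - {v}) = 2" using c3 v by auto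
    \<comment> \<open>Two triangles at \<open>v\<close> need two further vertices each, but
      \<open>v\<close> has at most three neighbours. They share a vertex \<open>a\<close>, and then
      \<open>b\<close>, \<open>b'\<close> are common neighbours of \<open>v\<close> and
      \<open>a\<close>.\<close>
    have "T - {v} \<union> (T' - {v}) \<subseteq> nb C v" using adj TF v by blast
    then have "card (T - {v} \<union> (T' - {v})) \<le> 3" using card_mono[OF D(4)] D(5)[of v] order_trans by blast
    moreover have "card (T - {v}) + card (T' - {v}) = card (T - {v} \<union> (T' - {v})) + card ((T - {v}) \<inter> (T' - {v}))"
      using c3 by (intro card_Un_Int) auto
    ultimately have "card ((T - {v}) \<inter> (T' - {v})) \<noteq> 0" using cT by linarith
    then obtain a where a: "a \<in> T" "a \<in> T'" "a \<noteq> v"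
      by (metis (no_types, lifting) Diff_iff IntE card.empty equals0I singletonI)
    have "card (T - {v, a}) = 1" "card (T' - {v, a}) = 1" using c3 v a by (simp_all add: card_Diff_subset)
    then obtain b b' where b: "T - {v, a} = {b}" "T' - {v, a} = {b'}" by (metis card_1_singletonE)
    have bT: "b \<in> T" "b \<noteq> v" "b \<noteq> a" "b' \<in> T'" "b' \<noteq> v" "b' \<noteq> a" using b by blast+
    have "b = b'"
      using safe_diamond_free[OF safe, of a v b b'] adj[OF TF(1) v(1) a(1)] adj[OF TF(1) v(1) bT(1)]
        adj[OF TF(1) a(1) bT(1)] adj[OF TF(2) v(2) bT(4)] adj[OF TF(2) a(2) bT(4)] bT a(3) by simp
    moreover have "T = {v, a, b}" "T' = {v, a, b'}" using b v a by blast+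
    ultimately have "T = T'" by simp
    then show False using TF by blast
  qed
  have "card (\<Union>F) = (\<Sum>T\<in>F. card T)"
    by (rule card_Union_disjoint) (use dis in \<open>auto simp: pairwise_def disjnt_def F_def card_ge_0_finite\<close>)
  also have "\<dots> = 3 * card F" unfolding F_def by simp
  finally have "3 * card F \<le> n"
    using card_mono[of "{..<n}" "\<Union>F"] unfolding F_def by auto
  then show ?thesis unfolding triangles_def F_def by linarith
qed

section \<open>From Blocker's invariant to a bound on the game value\<close>

lemma finite_unclaimed: "finite (unclaimed n C B)"
  unfolding unclaimed_def using finite_all_edges by auto

lemma finite_constructor_moves: "finite (constructor_moves n C B)"
  unfolding constructor_moves_def using finite_unclaimed by auto

text \<open>\<open>P\<close> is an invariant for positions with Constructor to move. A full round
  consumes two units of fuel, hence the strong induction; \<open>move\<close> covers play that stops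
  between Constructor's move and the reply.\<close>

lemma gval_True_le:
  assumes tri: "\<And>C B. P C B \<Longrightarrow> triangles n C \<le> m"
    and move: "\<And>C B e. P C B \<Longrightarrow> e \<in> constructor_moves n C B \<Longrightarrow> triangles n (insert e C) \<le> m"
    and reply: "\<And>C B e. P C B \<Longrightarrow> e \<in> constructor_moves n C B \<Longrightarrow> unclaimed n (insert e C) B \<noteq> {} \<Longrightarrow>
      \<exists>f\<in>unclaimed n (insert e C) B. P (insert e C) (insert f B)"
  shows "P C B \<Longrightarrow> gval k n True C B \<le> m"
proof (induction k arbitrary: C B rule: less_induct)
  case (less k)
  show ?case
  proof (cases k)
    case 0
    then show ?thesis using tri less by simp
  next
    case (Suc j)
    have "gval j n False (insert e C) B \<le> m" if e: "e \<in> constructor_moves n C B" for e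
    proof (cases j)
      case 0
      then show ?thesis using move less e by simp
    next
      case (Suc i)
      show ?thesis
      proof (cases "constructor_moves n (insert e C) B = {} \<or> unclaimed n (insert e C) B = {}")
        case True
        then show ?thesis using move less e Suc by simp
      next
        case False
        then obtain f where f: "f \<in> unclaimed n (insert e C) B" "P (insert e C) (insert f B)"
          using reply less.prems e by blast
        have "gval j n False (insert e C) B \<le> gval i n True (insert e C) (insert f B)"
          using False f Suc finite_unclaimed by (auto intro!: Min_le)
        also have "\<dots> \<le> m" using less.IH[of i] f(2) Suc \<open>k = Suc j\<close> by simp
        finally show ?thesis .
      qed
    qed
    then show ?thesis using Suc tri less.prems finite_constructor_moves by simp
  qed
qed

lemma safe_empty: "safe (nb {}) B"
  unfolding safe_def nbrs3_def live_def nb_def by auto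

theorem game_value_le: "game_value n \<le> n div 3"
proof -
  define P where "P C B \<longleftrightarrow> C \<subseteq> all_edges n \<and> safe (nb C) (B \<union> - all_edges n)" for C B
  have resp: "insert e C \<subseteq> all_edges n \<and> (\<exists>f. safe (nb (insert e C)) (insert f (B \<union> - all_edges n)))"
    if PC: "P C B" and e: "e \<in> constructor_moves n C B" for C B e
  proof -
    from PC have C: "C \<subseteq> all_edges n" and s: "safe (nb C) (B \<union> - all_edges n)" unfolding P_def by auto
    obtain x y where xy: "e = {x, y}" "av (nb C) (B \<union> - all_edges n) x y" "insert e C \<subseteq> all_edges n"
      using constructor_moveE[OF C e] .
    then have "nb (insert e C) = link x y (nb C)" using nb_insert unfolding av_def by blast
    then show ?thesis using safe_response[OF s xy(2)] xy(3) by simp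
  qed
  have "gval k n True {} {} \<le> n div 3" for k
  proof (rule gval_True_le[where P = P])
    fix C B assume "P C B"
    then show "triangles n C \<le> n div 3" unfolding P_def using triangles_le_of_safe by blast
  next
    fix C B e assume "P C B" "e \<in> constructor_moves n C B"
    from resp[OF this] show "triangles n (insert e C) \<le> n div 3" using triangles_le_of_safe by blast
  next
    fix C B e assume h: "P C B" "e \<in> constructor_moves n C B" "unclaimed n (insert e C) B \<noteq> {}"
    let ?C = "insert e C" and ?B = "B \<union> - all_edges n"
    obtain f where f: "?C \<subseteq> all_edges n" "safe (nb ?C) (insert f ?B)" using resp[OF h(1,2)] by blast
    show "\<exists>f\<in>unclaimed n ?C B. P ?C (insert f B)"
    proof (cases "f \<in> unclaimed n ?C B")
      case True
      then show ?thesis using f unfolding P_def by auto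
    next
      \<comment> \<open>The suggested reply may be illegal: already claimed or off the board. Then
        it changes no availability, and by monotonicity any legal move \<open>g\<close> serves
        instead.\<close>
      case False
      then have "f \<in> ?C \<or> f \<in> ?B" unfolding unclaimed_def by auto
      then have "av (nb ?C) (insert f ?B) a b \<longleftrightarrow> av (nb ?C) ?B a b" for a b
        unfolding av_def mem_nb by auto
      then have "safe (nb ?C) ?B" using f(2) safe_cong by blast
      then have "safe (nb ?C) (insert g B \<union> - all_edges n)" for g by (rule safe_mono) auto
      then show ?thesis using h(3) f(1) unfolding P_def by blast
    qed
  next
    show "P {} {}" unfolding P_def using safe_empty by simp
  qed
  then show ?thesis unfolding game_value_def .
qed

section \<open>Lower bound\<close>

text \<open>
  In \<open>step\<close> the game must not end right after the move, since otherwise Blocker's reply does not take place.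
\<close>

inductive force :: "nat \<Rightarrow> nat \<Rightarrow> nat set set \<Rightarrow> nat set set \<Rightarrow> bool" for n m where
  stop: "m \<le> triangles n C \<Longrightarrow> force n m C B"
| step: "e \<in> constructor_moves n C B \<Longrightarrow> constructor_moves n (insert e C) B \<noteq> {} \<Longrightarrow>
    (\<And>f. f \<in> unclaimed n (insert e C) B \<Longrightarrow> force n m (insert e C) (insert f B)) \<Longrightarrow> force n m C B"

section \<open>Forced triangles bound the minimax value from below\<close>

lemma triangles_mono:
  assumes "C \<subseteq> C'"
  shows "triangles n C \<le> triangles n C'"
  unfolding triangles_def
  by (rule card_mono, rule finite_subset[of _ "Pow {..<n}"]) (use assms in auto)

lemma triangles_insert:
  assumes "{x, y} \<notin> C" "{x, z} \<in> C" "{y, z} \<in> C" "C \<subseteq> all_edges n" "x \<noteq> y"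
  shows "Suc (triangles n C) \<le> triangles n (insert {x, y} C)"
proof -
  define F where "F C = {T. T \<subseteq> {..<n} \<and> card T = 3 \<and> (\<forall>x\<in>T. \<forall>y\<in>T. x \<noteq> y \<longrightarrow> {x, y} \<in> C)}" for C
  have fin: "finite (F C)" for C unfolding F_def by (rule finite_subset[of _ "Pow {..<n}"]) auto
  have z: "x < n" "y < n" "z < n" "x \<noteq> z" "y \<noteq> z"
    using assms doubleton_in_all_edges[of x z n] doubleton_in_all_edges[of y z n] by auto
  then have "{x, y, z} \<in> F (insert {x, y} C)"
    using assms unfolding F_def by (auto simp: insert_commute)
  moreover have "{x, y, z} \<notin> F C" using assms unfolding F_def by auto
  moreover have "F C \<subseteq> F (insert {x, y} C)" unfolding F_def by auto
  ultimately have "F C \<subset> F (insert {x, y} C)" by blast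
  then have "card (F C) < card (F (insert {x, y} C))" by (rule psubset_card_mono[OF fin])
  then show ?thesis unfolding triangles_def F_def by simp
qed

text \<open>Later moves only add edges for Constructor, so triangles already built survive any play.
  This settles the case \<open>stop\<close>.\<close>

lemma triangles_le_gval: "triangles n C \<le> gval k n t C B"
proof (induction k arbitrary: t C B)
  case (Suc k)
  show ?case
  proof (cases t)
    case True
    show ?thesis
    proof (cases "constructor_moves n C B = {}")
      case False
      then obtain e where e: "e \<in> constructor_moves n C B" by blast
      have "triangles n C \<le> triangles n (insert e C)" by (rule triangles_mono) auto
      also have "\<dots> \<le> gval k n False (insert e C) B" by (rule Suc)
      also have "\<dots> \<le> gval (Suc k) n t C B"
        using e False True finite_constructor_moves by (auto intro!: Max_ge)
      finally show ?thesis .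
    qed (use True in simp)
  next
    case False
    then show ?thesis using Suc finite_unclaimed by (auto simp: Min_ge_iff)
  qed
qed simp

lemma force_le_gval:
  "force n m C B \<Longrightarrow> card (unclaimed n C B) \<le> k \<Longrightarrow> m \<le> gval k n True C B"
proof (induction arbitrary: k rule: force.induct)
  case (stop C B)
  then show ?case using triangles_le_gval order_trans by blast
next
  case (step e C B)
  let ?C = "insert e C"
  have e: "e \<in> unclaimed n C B" using step.hyps(1) unfolding constructor_moves_def by auto
  have "unclaimed n ?C B \<noteq> {}" using step.hyps(2) unfolding constructor_moves_def by auto
  moreover have u: "unclaimed n ?C B = unclaimed n C B - {e}" unfolding unclaimed_def by auto
  ultimately have "card (unclaimed n C B - {e}) > 0" using finite_unclaimed[of n C B] by (simp add: card_gt_0_iff)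
  \<comment> \<open>Besides \<open>e\<close> some other edge is still unclaimed, so the fuel
    suffices for Constructor's move and the reply.\<close>
  then have "2 \<le> card (unclaimed n C B)" using e finite_unclaimed[of n C B] by simp
  then obtain j where j: "k = Suc (Suc j)" using step.prems that[of "k - 2"] by simp
  have "m \<le> gval j n True ?C (insert f B)" if f: "f \<in> unclaimed n ?C B" for f
  proof (rule step.IH[OF f])
    have "unclaimed n ?C (insert f B) = unclaimed n C B - {e} - {f}" unfolding unclaimed_def by auto
    then show "card (unclaimed n ?C (insert f B)) \<le> j"
      using e f u step.prems j finite_unclaimed[of n C B] by auto
  qed
  then have "m \<le> gval (Suc j) n False ?C B"
    using step.hyps(2) \<open>unclaimed n ?C B \<noteq> {}\<close> finite_unclaimed by (auto simp: Min_ge_iff)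
  also have "\<dots> \<le> gval k n True C B"
    using step.hyps(1) j finite_constructor_moves by (auto intro!: Max_ge)
  finally show ?case .
qed

section \<open>Legal moves of Constructor and the reserve that keeps the game running\<close>

definition subcubic :: "nat \<Rightarrow> nat set set \<Rightarrow> bool" where
  "subcubic n C \<longleftrightarrow> C \<subseteq> all_edges n \<and> (\<forall>v. card (nb C v) \<le> 3)"

lemma subcubic_insert:
  assumes "subcubic n C" "x < n" "y < n" "x \<noteq> y" "card (nb C x) \<le> 2" "card (nb C y) \<le> 2"
  shows "subcubic n (insert {x, y} C)"
proof -
  have "C \<subseteq> all_edges n" using assms unfolding subcubic_def by auto
  then have f: "finite (nb C v)" for v by (rule finite_nb)
  have "card (nb (insert {x, y} C) v) \<le> 3" for v
    using assms f[of x] f[of y] unfolding nb_insert[OF assms(4)] link_def subcubic_def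
    by (auto simp: card_insert_if)
  then show ?thesis using assms doubleton_in_all_edges[of x y n] unfolding subcubic_def by auto
qed

lemma constructor_moveI:
  assumes "subcubic n C" "x < n" "y < n" "x \<noteq> y" "card (nb C x) \<le> 2" "card (nb C y) \<le> 2"
    and "{x, y} \<notin> C" "{x, y} \<notin> B"
  shows "{x, y} \<in> constructor_moves n C B"
proof -
  have "subcubic n (insert {x, y} C)" using subcubic_insert assms by blast
  then have "S4_free (insert {x, y} C)" using S4_free_iff unfolding subcubic_def by blast
  then show ?thesis using assms doubleton_in_all_edges[of x y n]
    unfolding constructor_moves_def unclaimed_def by auto
qed

lemma card_nb_insert_le:
  assumes "B \<subseteq> all_edges n" "f \<in> all_edges n"
  shows "card (nb (insert f B) v) \<le> Suc (card (nb B v))"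
proof -
  obtain a b where f: "f = {a, b}" "a \<noteq> b" using assms(2) by (rule all_edgesE)
  show ?thesis unfolding f nb_insert[OF f(2)] link_def
    using finite_nb[OF assms(1)] by (auto simp: card_insert_if)
qed

lemma ex_not_blocked:
  assumes "B \<subseteq> all_edges n" "card (nb B u) < card X"
  shows "\<exists>w\<in>X. {u, w} \<notin> B"
proof (rule ccontr)
  assume "\<not> ?thesis"
  then have "X \<subseteq> nb B u" unfolding nb_def by blast
  then show False using assms card_mono[OF finite_nb[OF assms(1)]] by (metis not_less)
qed

text \<open>Any \<open>u\<close> in \<open>X\<close> is blocked from at most \<open>E\<close> of the
  at least \<open>E + 1\<close> other vertices of \<open>X\<close>, so two untouched vertices can
  still be joined.\<close>

lemma constructor_moves_nonempty:
  assumes C: "subcubic n C" and B: "B \<subseteq> all_edges n" and X: "X \<subseteq> {..<n}" "\<And>v. v \<in> X \<Longrightarrow> nb C v = {}"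
    "\<And>v. v \<in> X \<Longrightarrow> card (nb B v) \<le> E" "E + 2 \<le> card X"
  shows "constructor_moves n C B \<noteq> {}"
proof -
  obtain u where u: "u \<in> X" using X(4) by (metis add_2_eq_Suc' card.empty equals0I le_zero_eq nat.simps(3))
  have "card (nb B u) < card (X - {u})" using X(3)[OF u] X(4) u by simp
  then obtain w where w: "w \<in> X" "w \<noteq> u" "{u, w} \<notin> B" using ex_not_blocked[OF B] by blast
  have "{u, w} \<notin> C" using X(2)[OF u] unfolding nb_def by auto
  then have "{u, w} \<in> constructor_moves n C B"
    using u w X(1,2) by (intro constructor_moveI[OF C]) auto
  then show ?thesis by blast
qed

text \<open>One move of Constructor with an arbitrary answer. The reserve \<open>X\<close> certifies
  that the game does not end before the answer.\<close>

lemma force_play: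
  assumes C: "subcubic n C" and B: "B \<subseteq> all_edges n"
    and xy: "x < n" "y < n" "x \<noteq> y" "card (nb C x) \<le> 2" "card (nb C y) \<le> 2" "{x, y} \<notin> C" "{x, y} \<notin> B"
    and X: "X \<subseteq> {..<n}" "x \<notin> X" "y \<notin> X" "\<And>v. v \<in> X \<Longrightarrow> nb C v = {}"
      "\<And>v. v \<in> X \<Longrightarrow> card (nb B v) \<le> E" "E + 2 \<le> card X"
    and cont: "\<And>f. f \<in> all_edges n \<Longrightarrow> subcubic n (insert {x, y} C) \<Longrightarrow> insert f B \<subseteq> all_edges n \<Longrightarrow>
      force n m (insert {x, y} C) (insert f B)"
  shows "force n m C B"
proof (rule force.step)
  show "{x, y} \<in> constructor_moves n C B" using constructor_moveI C xy by blast
  have C': "subcubic n (insert {x, y} C)" using subcubic_insert C xy by blast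
  then show "constructor_moves n (insert {x, y} C) B \<noteq> {}"
    by (rule constructor_moves_nonempty[OF _ B X(1) _ X(5,6)])
      (use X in \<open>auto simp: nb_insert[OF xy(3)] link_def\<close>)
  fix f assume "f \<in> unclaimed n (insert {x, y} C) B"
  then have "f \<in> all_edges n" unfolding unclaimed_def by auto
  then show "force n m (insert {x, y} C) (insert f B)" using cont C' B by auto
qed

lemma sum_card_nb_le:
  assumes "B \<subseteq> all_edges n" "finite F"
  shows "(\<Sum>v\<in>F. card (nb B v)) \<le> 2 * card B"
proof -
  have finB: "finite B" using assms finite_all_edges finite_subset by blast
  from finB assms(1) show ?thesis
  proof (induction B rule: finite_induct)
    case empty
    then show ?case by (simp add: nb_def)
  next
    case (insert e B)
    obtain x y where e: "e = {x, y}" "x \<noteq> y" using insert.prems all_edgesE by blast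
    have B: "B \<subseteq> all_edges n" using insert by auto
    have "card (nb (insert e B) v) \<le> card (nb B v) + (if v = x then 1 else 0) + (if v = y then 1 else 0)" for v
      using finite_nb[OF B, of v] unfolding e(1) nb_insert[OF e(2)] link_def by (auto simp: card_insert_if)
    then have "(\<Sum>v\<in>F. card (nb (insert e B) v))
        \<le> (\<Sum>v\<in>F. card (nb B v) + (if v = x then 1 else 0) + (if v = y then 1 else 0))"
      by (rule sum_mono)
    also have "\<dots> \<le> (\<Sum>v\<in>F. card (nb B v)) + 1 + 1"
      using assms(2) by (simp add: sum.distrib)
    also have "\<dots> \<le> 2 * card (insert e B)" using insert.IH[OF B] insert.hyps by simp
    finally show ?case .
  qed
qed

text \<open>
  \<open>F\<close> are the unused vertices, \<open>P\<close> is the pool, and \<open>j\<close> rounds remain, each answered by at most 4 moves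
  of Blocker. The bound on \<open>card B\<close> makes sure that most of \<open>F\<close> have blocked degree at most \<open>D\<close>.
\<close>

definition stage :: "nat \<Rightarrow> nat \<Rightarrow> nat \<Rightarrow> nat set set \<Rightarrow> nat set set \<Rightarrow> nat set \<Rightarrow> nat set \<Rightarrow> bool" where
  "stage n D j C B F P \<longleftrightarrow> subcubic n C \<and> B \<subseteq> all_edges n \<and> F \<subseteq> {..<n} \<and> P \<subseteq> {..<n} \<and> F \<inter> P = {}
    \<and> (\<forall>v\<in>F. nb C v = {}) \<and> (\<forall>v\<in>P. card (nb C v) \<le> 1)
    \<and> 3 * D + 20 \<le> card P \<and> 3 * D + 20 + 3 * j \<le> card F \<and> card B + 4 * j \<le> (D + 1)^2"

text \<open>Every other vertex of \<open>F\<close> has blocked degree at least \<open>D + 1\<close>.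
  By the handshake bound there are at most \<open>2 * (D + 1)\<close> of these among at least
  \<open>3 * D + 20\<close> vertices.\<close>

lemma stage_low:
  assumes "stage n D j C B F P"
  shows "D + 18 \<le> card {v \<in> F. card (nb B v) \<le> D}"
proof -
  define L where "L = {v \<in> F. card (nb B v) \<le> D}"
  from assms have F: "finite F" "3 * D + 20 \<le> card F" and B: "B \<subseteq> all_edges n" "card B \<le> (D + 1)^2"
    unfolding stage_def by (auto intro: finite_subset)
  have "(D + 1) * card (F - L) = (\<Sum>v\<in>F - L. D + 1)" by simp
  also have "\<dots> \<le> (\<Sum>v\<in>F - L. card (nb B v))" by (rule sum_mono) (auto simp: L_def)
  also have "\<dots> \<le> 2 * card B" using sum_card_nb_le[OF B(1)] F by simp
  also have "\<dots> \<le> (D + 1) * (2 * (D + 1))" using B(2) by (simp add: power2_eq_square)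
  finally have "card (F - L) \<le> 2 * (D + 1)" by (subst (asm) mult_le_cancel1) simp
  moreover have "card F = card L + card (F - L)"
    using F(1) card_Un_disjoint[of L "F - L"] by (auto simp: L_def Un_Diff_cancel2 Un_absorb1)
  ultimately have "D + 18 \<le> card L" using F(2) by presburger
  then show ?thesis unfolding L_def .
qed

lemma stage_round:
  assumes st: "stage n D (Suc j) C B F P"
    and cont: "\<And>C' B' F' P'. stage n D j C' B' F' P' \<Longrightarrow> Suc (triangles n C) \<le> triangles n C' \<Longrightarrow> force n m C' B'"
  shows "force n m C B"
proof -
  define L where "L = {v \<in> F. card (nb B v) \<le> D}"
  have L18: "D + 18 \<le> card L" using stage_low[OF st] unfolding L_def .
  from st have C: "subcubic n C" and B: "B \<subseteq> all_edges n" and F: "F \<subseteq> {..<n}" "\<And>v. v \<in> F \<Longrightarrow> nb C v = {}"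
    and P: "P \<subseteq> {..<n}" "\<And>v. v \<in> P \<Longrightarrow> card (nb C v) \<le> 1" and FP: "F \<inter> P = {}"
    and cP: "3 * D + 20 \<le> card P" and cF: "3 * D + 20 + 3 * Suc j \<le> card F" and cB: "card B + 4 * Suc j \<le> (D + 1)^2"
    unfolding stage_def by auto
  have finF: "finite F" and finP: "finite P" using F P by (auto intro: finite_subset)
  have LF: "L \<subseteq> F" "finite L" using finF unfolding L_def by auto
  have bL: "card (nb B v) \<le> D" if "v \<in> L" for v using that unfolding L_def by auto
  have nbL: "nb C v = {}" if "v \<in> L" for v using that LF F by auto
  have Ln: "L \<subseteq> {..<n}" using LF F by auto
  obtain v where v: "v \<in> L" using L18 by (metis add_is_0 card.empty equals0I le_zero_eq zero_neq_numeral)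
  have "card (nb B v) < card (L - {v})" using bL[OF v] L18 v LF by simp
  then obtain c where c: "c \<in> L" "c \<noteq> v" "{v, c} \<notin> B" using ex_not_blocked[OF B] by blast
  show ?thesis
  proof (rule force_play[OF C B, of v c "L - {v, c}" D])
    show "D + 2 \<le> card (L - {v, c})" using v c L18 LF by (simp add: card_Diff_subset)
    show "{v, c} \<notin> C" using nbL[OF v] unfolding nb_def by auto
    fix f1 let ?C1 = "insert {v, c} C" and ?B1 = "insert f1 B"
    assume f1: "f1 \<in> all_edges n" and C1: "subcubic n ?C1" and B1: "?B1 \<subseteq> all_edges n"
    have bL1: "card (nb ?B1 u) \<le> D + 1" if "u \<in> L" for u
      using card_nb_insert_le[OF B f1, of u] bL[OF that] by simp
    have n1: "nb ?C1 v = {c}" "nb ?C1 c = {v}" "\<And>u. u \<noteq> v \<Longrightarrow> u \<noteq> c \<Longrightarrow> nb ?C1 u = nb C u"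
      using nbL[OF v] nbL[OF c(1)] c(2) unfolding nb_insert[OF c(2)[symmetric]] link_def by auto
    have "card (nb ?B1 v) < card (L - {v, c})" using bL1[OF v] L18 v c LF by (simp add: card_Diff_subset)
    then obtain d where d: "d \<in> L" "d \<noteq> v" "d \<noteq> c" "{v, d} \<notin> ?B1" using ex_not_blocked[OF B1] by blast
    define X where "X = L - {v, c, d}"
    \<comment> \<open>The reserve has to meet the size condition up to the last move. Blocked
      degrees are then at most \<open>D + 3\<close>, so \<open>D + 5\<close> vertices are
      required.\<close>
    have cX: "D + 15 \<le> card X" unfolding X_def using v c d L18 LF by (simp add: card_Diff_subset)
    have vcd: "v \<in> F" "c \<in> F" "d \<in> F" "v < n" "c < n" "d < n" using v c d LF Ln by auto
    show "force n m ?C1 ?B1"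
    proof (rule force_play[OF C1 B1, of v d X "D + 1"])
      show "{v, d} \<notin> ?C1" using n1(1) d(3) unfolding nb_def by auto
      show "nb ?C1 u = {}" if "u \<in> X" for u using that n1(3)[of u] nbL unfolding X_def by auto
      show "card (nb ?C1 d) \<le> 2" using n1(3)[of d] d nbL by auto
      fix f2 define C2 where "C2 = insert {v, d} ?C1" define B2 where "B2 = insert f2 ?B1"
      assume f2: "f2 \<in> all_edges n" and C2: "subcubic n (insert {v, d} ?C1)" and B2: "insert f2 ?B1 \<subseteq> all_edges n"
      note C2 = C2[folded C2_def] and B2 = B2[folded B2_def]
      have bL2: "card (nb B2 u) \<le> D + 2" if "u \<in> L" for u
        using card_nb_insert_le[OF B1 f2, of u] bL1[OF that] unfolding B2_def by simp
      have n2: "nb C2 v = {c, d}" "nb C2 c = {v}" "nb C2 d = {v}"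
        "\<And>u. u \<noteq> v \<Longrightarrow> u \<noteq> c \<Longrightarrow> u \<noteq> d \<Longrightarrow> nb C2 u = nb C u"
        using n1 nbL[OF d(1)] c d unfolding C2_def nb_insert[OF d(2)[symmetric]] link_def by auto
      have cB2: "card B2 \<le> card B + 2" unfolding B2_def
        using card_insert_le_m1[of "card B + 2" ?B1 f2] card_insert_le_m1[of "card B + 1" B f1] by simp
      have nX: "nb C2 u = {}" if "u \<in> X" for u using that n2(4)[of u] nbL unfolding X_def by auto
      have Xn: "X \<subseteq> {..<n}" "v \<notin> X" "c \<notin> X" "d \<notin> X" using Ln unfolding X_def by auto
      have sub2: "C \<subseteq> C2" unfolding C2_def by auto
      show "force n m (insert {v, d} ?C1) (insert f2 ?B1)" unfolding C2_def[symmetric] B2_def[symmetric]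
      proof (cases "{c, d} \<in> B2")
        case False
        show "force n m C2 B2"
        proof (rule force_play[OF C2 B2, of c d X "D + 2"])
          show cd: "{c, d} \<notin> C2" using n2(2) d unfolding nb_def by auto
          show "card (nb B2 u) \<le> D + 2" if "u \<in> X" for u using bL2 that unfolding X_def by auto
          fix f3 let ?C3 = "insert {c, d} C2" and ?B3 = "insert f3 B2"
          assume f3: "f3 \<in> all_edges n" and C3: "subcubic n ?C3" and B3: "?B3 \<subseteq> all_edges n"
          show "force n m ?C3 ?B3"
          proof (rule cont)
            have n3: "nb ?C3 u = nb C u" if "u \<noteq> v" "u \<noteq> c" "u \<noteq> d" for u
              using n2(4) that d(3) unfolding nb_insert[OF d(3)[symmetric]] link_def by auto
            have "card (F - {v, c, d}) = card F - 3"
              using vcd c d finF by (simp add: card_Diff_subset)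
            moreover have "card ?B3 \<le> Suc (card B2)" by (rule card_insert_le_m1) auto
            moreover have "card (nb ?C3 u) \<le> 1" if "u \<in> P" for u
            proof -
              have "u \<noteq> v" "u \<noteq> c" "u \<noteq> d" using that FP vcd by auto
              then show ?thesis using n3 P(2)[OF that] by simp
            qed
            moreover have "(F - {v, c, d}) \<inter> P = {}" using FP by blast
            ultimately show "stage n D j ?C3 ?B3 (F - {v, c, d}) P"
              unfolding stage_def using C3 B3 F P(1) cP cF cB cB2 n3 by auto
            have "{c, v} \<in> C2" "{d, v} \<in> C2" unfolding C2_def by (auto simp: insert_commute)
            then have "Suc (triangles n C2) \<le> triangles n ?C3"
              using triangles_insert cd C2 d(3) unfolding subcubic_def by blast
            then show "Suc (triangles n C) \<le> triangles n ?C3" using triangles_mono[OF sub2, of n] by simp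
          qed
        qed (use vcd d Xn nX cX n2 False in auto)
      next
        case True
        \<comment> \<open>The three vertices are blocked from at most \<open>3 * D + 6\<close>
          vertices in total, fewer than the pool contains. So some pool vertex \<open>b\<close> is
          open to all of them.\<close>
        have "card (nb B2 v \<union> nb B2 c \<union> nb B2 d) \<le> 3 * (D + 2)"
          using card_Un_le[of "nb B2 v \<union> nb B2 c" "nb B2 d"] card_Un_le[of "nb B2 v" "nb B2 c"]
            bL2[OF v] bL2[OF c(1)] bL2[OF d(1)] by simp
        then have "\<not> P \<subseteq> nb B2 v \<union> nb B2 c \<union> nb B2 d"
          using card_mono[of "nb B2 v \<union> nb B2 c \<union> nb B2 d" P] finite_nb[OF B2] cP by fastforce
        then obtain b where b: "b \<in> P" "{v, b} \<notin> B2" "{c, b} \<notin> B2" "{d, b} \<notin> B2" unfolding nb_def by auto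
        have bn: "b \<noteq> v" "b \<noteq> c" "b \<noteq> d" "b \<notin> X" "b < n" using b(1) FP vcd P LF unfolding X_def by auto
        have nb2: "nb C2 b = nb C b" using n2(4) bn by auto
        show "force n m C2 B2"
        proof (rule force_play[OF C2 B2, of v b X "D + 2"])
          show "{v, b} \<notin> C2" using n2(1) bn unfolding nb_def by auto
          show "card (nb B2 u) \<le> D + 2" if "u \<in> X" for u using bL2 that unfolding X_def by auto
          show "card (nb C2 b) \<le> 2" using nb2 P(2)[OF b(1)] by simp
          fix f3 define C3 where "C3 = insert {v, b} C2" define B3 where "B3 = insert f3 B2"
          assume f3: "f3 \<in> all_edges n" and C3: "subcubic n (insert {v, b} C2)" and B3: "insert f3 B2 \<subseteq> all_edges n"
          note C3 = C3[folded C3_def] and B3 = B3[folded B3_def]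
          have n3: "nb C3 c = {v}" "nb C3 d = {v}" "nb C3 b = insert v (nb C b)"
             "\<And>u. u \<noteq> v \<Longrightarrow> u \<noteq> c \<Longrightarrow> u \<noteq> d \<Longrightarrow> u \<noteq> b \<Longrightarrow> nb C3 u = nb C u"
            using n2 nb2 bn c d unfolding C3_def nb_insert[OF bn(1)[symmetric]] link_def by auto
          have nX3: "nb C3 u = {}" if "u \<in> X" for u
            using nX[OF that] that Xn bn unfolding C3_def nb_insert[OF bn(1)[symmetric]] link_def by auto
          have cb3: "card (nb C3 b) \<le> 2"
            unfolding n3(3) using P(2)[OF b(1)] card_insert_le_m1[of 2 "nb C b" v] by simp
          have bL3: "card (nb B3 u) \<le> D + 3" if "u \<in> L" for u
            using card_nb_insert_le[OF B2 f3, of u] bL2[OF that] unfolding B3_def by simp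
          have cB3: "card B3 \<le> card B + 3"
            using cB2 card_insert_le_m1[of "card B + 3" B2 f3] unfolding B3_def by simp
          have sub3: "C \<subseteq> C3" using sub2 unfolding C3_def by auto
          \<comment> \<open>\<open>x\<close> is the one of \<open>c\<close>, \<open>d\<close> that
            is joined to \<open>b\<close>, closing the triangle \<open>x v b\<close>. The other one,
            \<open>y\<close>, has degree 1 and takes the place of \<open>b\<close> in the pool. As
            \<open>b\<close> had degree at most 1, its second new edge is legal.\<close>
          have fin: "force n m C3 B3" if xy: "{x, y} = {c, d}" and xb: "{x, b} \<notin> B3" for x y
          proof (rule force_play[OF C3 B3, of x b X "D + 3"])
            have x: "x = c \<and> y = d \<or> x = d \<and> y = c" using xy by (auto simp: doubleton_eq_iff)
            then have nx: "nb C3 x = {v}" "nb C3 y = {v}" "x \<noteq> y" "x \<noteq> b" "y \<noteq> b" "x \<noteq> v" "y \<noteq> v" "x < n" "x \<notin> X" "y \<in> F" "x \<in> F" "y < n"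
              using n3 d(3) bn c d vcd Xn by auto
            show "{x, b} \<notin> C3" using nx(1) bn unfolding nb_def by auto
            show "card (nb B3 u) \<le> D + 3" if "u \<in> X" for u using bL3 that unfolding X_def by auto
            show "x < n" "b < n" "x \<noteq> b" "card (nb C3 x) \<le> 2" "x \<notin> X" "b \<notin> X" using nx bn by auto
            fix f4 let ?C4 = "insert {x, b} C3" and ?B4 = "insert f4 B3"
            assume C4: "subcubic n ?C4" and B4: "?B4 \<subseteq> all_edges n"
            show "force n m ?C4 ?B4"
            proof (rule cont)
              have n4: "nb ?C4 u = nb C3 u" if "u \<noteq> x" "u \<noteq> b" for u
                using that unfolding nb_insert[OF nx(4)] link_def by auto
              have n4': "nb ?C4 u = nb C u" if "u \<noteq> v" "u \<noteq> c" "u \<noteq> d" "u \<noteq> b" for u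
                using n4[of u] n3(4)[of u] that x by auto
              have cF': "card (F - {v, c, d}) = card F - 3"
                using vcd c d finF by (simp add: card_Diff_subset)
              have yP: "y \<notin> P" using nx FP by auto
              have cP': "card (insert y (P - {b})) = card P" using yP card.remove[OF finP b(1)] finP by simp
              have cB4: "card ?B4 \<le> card B + 4" using cB3 card_insert_le_m1[of "card B + 4" B3 f4] by simp
              have y1: "nb ?C4 y = {v}" using n4[of y] nx by auto
              have P4: "\<forall>u\<in>insert y (P - {b}). card (nb ?C4 u) \<le> 1"
              proof
                fix u assume u: "u \<in> insert y (P - {b})"
                show "card (nb ?C4 u) \<le> 1"
                proof (cases "u = y")
                  case True
                  then show ?thesis using y1 by simp
                next
                  case False
                  then have "u \<in> P" "u \<noteq> b" using u by auto
                  moreover have "u \<noteq> v" "u \<noteq> c" "u \<noteq> d" using \<open>u \<in> P\<close> FP vcd by auto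
                  ultimately show ?thesis using n4' P(2) by simp
                qed
              qed
              have F4: "\<forall>u\<in>F - {v, c, d}. nb ?C4 u = {}"
              proof
                fix u assume u: "u \<in> F - {v, c, d}"
                moreover have "u \<noteq> b" using u b(1) FP by auto
                ultimately show "nb ?C4 u = {}" using n4'[of u] F(2)[of u] by simp
              qed
              have disj: "(F - {v, c, d}) \<inter> insert y (P - {b}) = {}" using FP x by auto
              show "stage n D j ?C4 ?B4 (F - {v, c, d}) (insert y (P - {b}))"
                unfolding stage_def using C4 B4 F(1) P(1) disj F4 P4 cF' cP' cP cF cB cB4 nx(12) by auto
              have "{x, v} \<in> C3" "{b, v} \<in> C3" using nx(1) n3(3) unfolding nb_def by auto
              then have "Suc (triangles n C3) \<le> triangles n ?C4"
                using triangles_insert \<open>{x, b} \<notin> C3\<close> C3 nx(4) unfolding subcubic_def by blast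
              then show "Suc (triangles n C) \<le> triangles n ?C4" using triangles_mono[OF sub3, of n] by simp
            qed
          qed (use Xn nX3 cb3 cX xb in auto)
          \<comment> \<open>The double threat: the single edge \<open>f3\<close> cannot be both
            closing edges.\<close>
          have "{c, b} \<noteq> {d, b}" using d(3) by (simp add: doubleton_eq_iff)
          then have "{c, b} \<notin> B3 \<or> {d, b} \<notin> B3" using b(3,4) unfolding B3_def by blast
          then have "force n m C3 B3"
            using fin[of c d, OF refl] fin[of d c, OF insert_commute] by blast
          then show "force n m (insert {v, b} C2) (insert f3 B2)" unfolding C3_def B3_def .
        qed (use vcd bn Xn nX cX n2 b d in auto)
      qed
    qed (use vcd v c d n1 bL1 cX Ln in \<open>auto simp: X_def\<close>)
  qed (use v c nbL bL Ln in auto)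
qed

lemma stage_force:
  "stage n D j C B F P \<Longrightarrow> k \<le> triangles n C + j \<Longrightarrow> force n k C B"
proof (induction j arbitrary: C B F P)
  case 0
  then show ?case by (auto intro: force.stop)
next
  case (Suc j)
  show ?case
    by (rule stage_round[OF Suc.prems(1)], rule Suc.IH) (use Suc.prems in auto)
qed

section \<open>Choice of parameters and the asymptotic estimate\<close>

lemma game_value_ge:
  assumes "4 * j \<le> (D + 1)^2" "6 * D + 40 + 3 * j \<le> n"
  shows "j \<le> game_value n"
proof -
  have "stage n D j {} {} {3 * D + 20..<n} {..<3 * D + 20}"
    using assms unfolding stage_def subcubic_def nb_def by auto
  then have "force n j {} {}" by (rule stage_force) simp
  then have "j \<le> gval (card (all_edges n)) n True {} {}"
    by (rule force_le_gval) (simp add: unclaimed_def)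
  then show ?thesis unfolding game_value_def .
qed

lemma game_value_ge_real: "real n / 3 - 2 * sqrt (2 * real n) - 17 \<le> real (game_value n)"
proof -
  \<comment> \<open>With this \<open>D\<close> the square exceeds the number of Blocker's moves, as
    \<open>4 * j\<close> is at most \<open>4 * n / 3\<close>. The vertices set aside still number
    only \<open>O(sqrt n)\<close>.\<close>
  define D where "D = nat \<lceil>sqrt (2 * real n)\<rceil>"
  define j where "j = (n - (6 * D + 40)) div 3"
  have D: "sqrt (2 * real n) \<le> real D" "real D \<le> sqrt (2 * real n) + 1"
  proof -
    have "0 \<le> sqrt (2 * real n)" by simp
    then have "0 \<le> \<lceil>sqrt (2 * real n)\<rceil>" by linarith
    then have "real D = real_of_int \<lceil>sqrt (2 * real n)\<rceil>" unfolding D_def by simp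
    then show "sqrt (2 * real n) \<le> real D" "real D \<le> sqrt (2 * real n) + 1" by linarith+
  qed
  show ?thesis
  proof (cases "6 * D + 40 \<le> n")
    case True
    have "2 * real n = (sqrt (2 * real n))^2" by simp
    also have "\<dots> \<le> (real D)^2" using D(1) by (intro power_mono) auto
    finally have "2 * n \<le> D^2" by (metis of_nat_le_iff of_nat_mult of_nat_numeral of_nat_power)
    then have "4 * j \<le> (D + 1)^2" unfolding j_def by (auto simp: power2_eq_square)
    moreover have "6 * D + 40 + 3 * j \<le> n" using True unfolding j_def by presburger
    ultimately have "j \<le> game_value n" by (rule game_value_ge)
    \<comment> \<open>Rounding down in the division by 3 loses at most 2 beyond the 40.\<close>
    moreover have "n \<le> 3 * j + 6 * D + 42" using True unfolding j_def by presburger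
    then have "real n \<le> 3 * real j + 6 * real D + 42" by linarith
    ultimately show ?thesis using D(2) by (simp add: field_simps)
  next
    \<comment> \<open>For these \<open>n\<close> the lower bound is negative, so it holds
      trivially.\<close>
    case False
    then have "real n \<le> 6 * real D + 39" by linarith
    then show ?thesis using D(2) by (simp add: field_simps)
  qed
qed

theorem theorem1p3:
  shows "(\<lambda>n. real (game_value n)) \<sim>[at_top] (\<lambda>n. real n / 3)"
proof (rule asymp_equiv_sandwich_real)
  show "(\<lambda>n. real n / 3 - 2 * sqrt (2 * real n) - 17) \<sim>[at_top] (\<lambda>n. real n / 3)"
    by real_asymp
  show "(\<lambda>n. real n / 3) \<sim>[at_top] (\<lambda>n. real n / 3)" by simp
  have "real (game_value n) \<le> real n / 3" for n
    using game_value_le[of n] by linarith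
  then show "\<forall>\<^sub>F n in at_top. real (game_value n) \<in> {real n / 3 - 2 * sqrt (2 * real n) - 17..real n / 3}"
    using game_value_ge_real by (intro always_eventually) auto
qed

end
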